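(* A full order $\mathcal H$ of $\mathbb A=\mathbb M_2(K)$ is a Bass order if and only if its branch $\mathfrak s_K(\mathcal H)$ is a line, as a subgraph of the Bruhat–Tits tree $\mathfrak t(K)$.
   Context: $K$ is a non-archimedean local field with ring of integers $\mathcal O_K$ and uniformizer $\pi_K$; $\mathbb A=\mathbb M_2(K)$ with identity $\mathbf 1$. An order of $\mathbb A$ is a subring containing $\mathbf 1$ which is a finitely generated $\mathcal O_K$-submodule; it is full if it spans $\mathbb A$ over $K$. A full order $\mathcal R$ is Gorenstein if its codifferent $\{a\in\mathbb A:\mathrm{tr}(a\mathcal R)\subseteq\mathcal O_K\}$ is invertible as a two-sided fractional $\mathcal R$-ideal; a full order is Bass if every order containing it is Gorenstein. The Bruhat–Tits tree $\mathfrak t(K)$ is the graph whose vertices are the maximal orders of $\mathbb A$, two of them being adjacent iff in some basis of $K^2$ they equal $\mathbb M_2(\mathcal O_K)$ and $\begin{pmatrix}\mathcal O_K&\pi_K^{-1}\mathcal O_K\\ \pi_K\mathcal O_K&\mathcal O_K\end{pmatrix}$ respectively. The branch $\mathfrak s_K(\mathcal H)$ is the induced subgraph of $\mathfrak t(K)$ whose vertices are the maximal orders containing $\mathcal H$. A line is a subgraph isomorphic to a connected subgraph of the graph with vertex set $\mathbb Z$ and edges joining consecutive integers (in particular a single vertex is a line). *)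

theory Defs
  imports "HOL-Analysis.Analysis"
begin

text \<open>The valuation v is only meaningful on nonzero elements.\<close>

definition val_ball :: "('a::field \<Rightarrow> int) \<Rightarrow> int \<Rightarrow> 'a set" where
  "val_ball v n = {x. x = 0 \<or> v x \<ge> n}"

abbreviation int_ring :: "('a::field \<Rightarrow> int) \<Rightarrow> 'a set" where
  "int_ring v \<equiv> val_ball v 0"

definition nonarch_local_field :: "('a::field \<Rightarrow> int) \<Rightarrow> bool" where
  "nonarch_local_field v \<longleftrightarrow>
     (\<forall>x y. x \<noteq> 0 \<longrightarrow> y \<noteq> 0 \<longrightarrow> v (x * y) = v x + v y) \<and>
     (\<forall>x y. x \<noteq> 0 \<longrightarrow> y \<noteq> 0 \<longrightarrow> x + y \<noteq> 0 \<longrightarrow> v (x + y) \<ge> min (v x) (v y)) \<and>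
     (\<exists>p. p \<noteq> 0 \<and> v p = 1) \<and>
     \<comment> \<open>finite residue field\<close>
     (\<exists>S. finite S \<and> S \<subseteq> int_ring v \<and> (\<forall>x\<in>int_ring v. \<exists>s\<in>S. x - s \<in> val_ball v 1)) \<and>
     \<comment> \<open>completeness\<close>
     (\<forall>X::nat \<Rightarrow> 'a. (\<forall>N. \<exists>M. \<forall>m\<ge>M. \<forall>n\<ge>M. X m - X n \<in> val_ball v N) \<longrightarrow>
        (\<exists>L. \<forall>N. \<exists>M. \<forall>n\<ge>M. X n - L \<in> val_ball v N))"

type_synonym 'a mat2 = "'a^2^2"

definition msc :: "'a::field \<Rightarrow> 'a mat2 \<Rightarrow> 'a mat2" where
  "msc c A = (\<chi> i j. c * A$i$j)"

definition lin_combs :: "'a::field set \<Rightarrow> 'a mat2 set \<Rightarrow> 'a mat2 set" where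
  "lin_combs C M = {(\<Sum>B\<in>F. msc (c B) B) | F c. finite F \<and> F \<subseteq> M \<and> (\<forall>B\<in>F. c B \<in> C)}"

definition fg_OK_module :: "('a::field \<Rightarrow> int) \<Rightarrow> 'a mat2 set \<Rightarrow> bool" where
  "fg_OK_module v M \<longleftrightarrow> (\<exists>G. finite G \<and> M = lin_combs (int_ring v) G)"

definition spans_A :: "'a::field mat2 set \<Rightarrow> bool" where
  "spans_A M \<longleftrightarrow> lin_combs UNIV M = UNIV"

definition is_order :: "('a::field \<Rightarrow> int) \<Rightarrow> 'a mat2 set \<Rightarrow> bool" where
  "is_order v R \<longleftrightarrow> mat 1 \<in> R \<and> 0 \<in> R \<and>
     (\<forall>x\<in>R. \<forall>y\<in>R. x + y \<in> R \<and> x - y \<in> R \<and> x ** y \<in> R) \<and> fg_OK_module v R"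

definition full_order :: "('a::field \<Rightarrow> int) \<Rightarrow> 'a mat2 set \<Rightarrow> bool" where
  "full_order v R \<longleftrightarrow> is_order v R \<and> spans_A R"

definition set_mult :: "'a::field mat2 set \<Rightarrow> 'a mat2 set \<Rightarrow> 'a mat2 set" where
  "set_mult I J = {(\<Sum>k\<in>F. x k ** y k) | F x y. finite (F::nat set) \<and> (\<forall>k\<in>F. x k \<in> I \<and> y k \<in> J)}"

definition frac_ideal :: "('a::field \<Rightarrow> int) \<Rightarrow> 'a mat2 set \<Rightarrow> 'a mat2 set \<Rightarrow> bool" where
  "frac_ideal v R I \<longleftrightarrow> fg_OK_module v I \<and> spans_A I \<and>
     (\<forall>r\<in>R. \<forall>x\<in>I. r ** x \<in> I \<and> x ** r \<in> I)"

definition invertible_ideal :: "('a::field \<Rightarrow> int) \<Rightarrow> 'a mat2 set \<Rightarrow> 'a mat2 set \<Rightarrow> bool" where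
  "invertible_ideal v R I \<longleftrightarrow> frac_ideal v R I \<and>
     (\<exists>J. frac_ideal v R J \<and> set_mult I J = R \<and> set_mult J I = R)"

definition codifferent :: "('a::field \<Rightarrow> int) \<Rightarrow> 'a mat2 set \<Rightarrow> 'a mat2 set" where
  "codifferent v R = {a. \<forall>r\<in>R. trace (a ** r) \<in> int_ring v}"

definition gorenstein :: "('a::field \<Rightarrow> int) \<Rightarrow> 'a mat2 set \<Rightarrow> bool" where
  "gorenstein v R \<longleftrightarrow> full_order v R \<and> invertible_ideal v R (codifferent v R)"

definition bass :: "('a::field \<Rightarrow> int) \<Rightarrow> 'a mat2 set \<Rightarrow> bool" where
  "bass v H \<longleftrightarrow> full_order v H \<and> (\<forall>R. is_order v R \<and> H \<subseteq> R \<longrightarrow> gorenstein v R)"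

definition maximal_order :: "('a::field \<Rightarrow> int) \<Rightarrow> 'a mat2 set \<Rightarrow> bool" where
  "maximal_order v D \<longleftrightarrow> is_order v D \<and> (\<forall>R. is_order v R \<and> D \<subseteq> R \<longrightarrow> R = D)"

definition std_max :: "('a::field \<Rightarrow> int) \<Rightarrow> 'a mat2 set" where
  "std_max v = {A. \<forall>i j. A$i$j \<in> int_ring v}"

definition std_nbr :: "('a::field \<Rightarrow> int) \<Rightarrow> 'a mat2 set" where
  "std_nbr v = {A. A$1$1 \<in> int_ring v \<and> A$1$2 \<in> val_ball v (-1) \<and>
                   A$2$1 \<in> val_ball v 1 \<and> A$2$2 \<in> int_ring v}"

definition conj_set :: "'a::field mat2 \<Rightarrow> 'a mat2 set \<Rightarrow> 'a mat2 set" where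
  "conj_set g S = (\<lambda>A. g ** A ** matrix_inv g) ` S"

definition bt_adj :: "('a::field \<Rightarrow> int) \<Rightarrow> 'a mat2 set \<Rightarrow> 'a mat2 set \<Rightarrow> bool" where
  "bt_adj v D1 D2 \<longleftrightarrow> maximal_order v D1 \<and> maximal_order v D2 \<and>
     (\<exists>g. invertible g \<and>
        ((D1 = conj_set g (std_max v) \<and> D2 = conj_set g (std_nbr v)) \<or>
         (D2 = conj_set g (std_max v) \<and> D1 = conj_set g (std_nbr v))))"

text \<open>Vertex set of the branch s_K(H); the branch is the induced subgraph of the tree on it.\<close>
definition branch :: "('a::field \<Rightarrow> int) \<Rightarrow> 'a mat2 set \<Rightarrow> 'a mat2 set set" where
  "branch v H = {D. maximal_order v D \<and> H \<subseteq> D}"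

text \<open>A graph (V, E) is a line if it is isomorphic to a connected subgraph of the
  path graph on the integers, i.e. to the path graph on a nonempty interval of integers.\<close>
definition is_line :: "'b set \<Rightarrow> ('b \<Rightarrow> 'b \<Rightarrow> bool) \<Rightarrow> bool" where
  "is_line V E \<longleftrightarrow> (\<exists>(I::int set) f. I \<noteq> {} \<and>
      (\<forall>a\<in>I. \<forall>c\<in>I. \<forall>b. a \<le> b \<and> b \<le> c \<longrightarrow> b \<in> I) \<and>
      bij_betw f I V \<and>
      (\<forall>a\<in>I. \<forall>b\<in>I. E (f a) (f b) \<longleftrightarrow> \<bar>a - b\<bar> = 1))"

end

theory Submission
  imports Defs
begin

text \<open>
  Maximal orders of \<open>M\<^sub>2(K)\<close> are the stabilisers of the lattices spanned by \<open>(p^m, 0)\<close> and \<open>(a, 1)\<close>, so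
  the vertices of the tree correspond to closed balls \<open>a + p^m O\<close> of \<open>K\<close>, and two of them are adjacent
  iff one ball is a maximal proper sub-ball of the other. If \<open>D\<close> is a maximal order, then \<open>O + pD\<close> lies in
  \<open>D\<close> and all its neighbours, whereas three neighbours of \<open>D\<close> already intersect inside \<open>O + pD\<close>. As the branch
  of a full order is a finite convex set of vertices, it is a line iff the order is contained in no \<open>O + pD\<close>.

  The order \<open>O + pD\<close> is not Gorenstein, by a direct computation with its codifferent. Conversely, let
  \<open>R\<close> have the basis \<open>1, e1, e2, e3\<close> and let \<open>f1, f2, f3\<close> be the dual basis of the traceless part
  of its codifferent, so that \<open>f2 f3 = t (e1 - s1)\<close> and cyclically for some \<open>t\<close>. The quadratic form
  \<open>det / t\<close> on the span of the \<open>fi\<close> is integral. If it takes a unit value at \<open>y\<close>, then \<open>y\<close> generates the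
  codifferent, which is therefore invertible. Otherwise the form is divisible by \<open>p\<close>, the elements
  \<open>fi fj / (p t)\<close> and \<open>1\<close> span an order \<open>G\<close>, and \<open>R \<subseteq> O + pG\<close>.
\<close>

section \<open>Two by two matrices\<close>

definition M2 :: "'a \<Rightarrow> 'a \<Rightarrow> 'a \<Rightarrow> 'a \<Rightarrow> 'a::field mat2" where
  "M2 a b c d = vector [vector [a, b], vector [c, d]]"

lemma M2_nth [simp]:
  "M2 a b c d $ 1 $ 1 = a" "M2 a b c d $ 1 $ 2 = b"
  "M2 a b c d $ 2 $ 1 = c" "M2 a b c d $ 2 $ 2 = d"
  by (simp_all add: M2_def)

lemma mat2_eq_iff:
  fixes A B :: "'a::field mat2"
  shows "A = B \<longleftrightarrow> A$1$1 = B$1$1 \<and> A$1$2 = B$1$2 \<and> A$2$1 = B$2$1 \<and> A$2$2 = B$2$2"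
  by (auto simp: vec_eq_iff forall_2)

lemma M2_cases [case_names M2]:
  obtains a b c d where "A = M2 a b c d"
proof
  show "A = M2 (A$1$1) (A$1$2) (A$2$1) (A$2$2)"
    by (simp add: mat2_eq_iff)
qed

lemma M2_eq [simp]: "M2 a b c d = M2 a' b' c' d' \<longleftrightarrow> a = a' \<and> b = b' \<and> c = c' \<and> d = d'"
  by (simp add: mat2_eq_iff)

lemma M2_add [simp]: "M2 a b c d + M2 a' b' c' d' = M2 (a + a') (b + b') (c + c') (d + d')"
  and M2_diff [simp]: "M2 a b c d - M2 a' b' c' d' = M2 (a - a') (b - b') (c - c') (d - d')"
  and M2_uminus [simp]: "- M2 a b c d = M2 (- a) (- b) (- c) (- d)"
  and M2_msc [simp]: "msc k (M2 a b c d) = M2 (k * a) (k * b) (k * c) (k * d)"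
  and M2_mult [simp]: "M2 a b c d ** M2 a' b' c' d' =
        M2 (a * a' + b * c') (a * b' + b * d') (c * a' + d * c') (c * b' + d * d')"
  and M2_trace [simp]: "trace (M2 a b c d) = a + d"
  and M2_det [simp]: "det (M2 a b c d) = a * d - b * c"
  by (simp_all add: mat2_eq_iff msc_def matrix_matrix_mult_def sum_2 trace_def det_2)

lemma mat_M2: "(mat k :: 'a::field mat2) = M2 k 0 0 k"
  and zero_M2: "(0 :: 'a mat2) = M2 0 0 0 0"
  by (simp_all add: mat2_eq_iff mat_def)

lemma msc_mult_left: "msc k A ** B = msc k (A ** B)"
  and msc_mult_right: "A ** msc k B = msc k (A ** B)"
  and msc_add: "msc k (A + B) = msc k A + msc k B"
  and msc_diff: "msc k (A - B) = msc k A - msc k B"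
  and msc_add_left: "msc (k + l) A = msc k A + msc l A"
  and msc_msc: "msc k (msc l A) = msc (k * l) A"
  and msc_1: "msc 1 A = A"
  and msc_0: "msc 0 A = 0"
  and msc_zero: "msc k 0 = 0"
  and msc_m1: "msc (- 1) A = - A"
  and mat_eq_msc: "mat k = msc k (mat 1)"
  by (cases A rule: M2_cases; cases B rule: M2_cases; simp add: algebra_simps zero_M2 mat_M2)+

lemma msc_sum: "msc k (\<Sum>x\<in>S. f x) = (\<Sum>x\<in>S. msc k (f x))"
  by (induction S rule: infinite_finite_induct) (simp_all add: msc_add msc_zero)

lemma matrix_inv_right: "invertible g \<Longrightarrow> g ** matrix_inv g = mat 1"
  and matrix_inv_left: "invertible g \<Longrightarrow> matrix_inv g ** g = mat 1"
  for g :: "'a::field mat2"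
  unfolding invertible_def matrix_inv_def
  by (metis (mono_tags, lifting) someI_ex)+

lemma matrix_inv_unique:
  fixes g h :: "'a::field mat2"
  assumes "g ** h = mat 1"
  shows "invertible g" "matrix_inv g = h"
proof -
  have hg: "h ** g = mat 1" using assms by (simp add: matrix_left_right_inverse)
  then show inv: "invertible g" using assms by (auto simp: invertible_def)
  have "matrix_inv g = matrix_inv g ** (g ** h)" by (simp add: assms)
  also have "\<dots> = h" using inv by (simp add: matrix_mul_assoc matrix_inv_left)
  finally show "matrix_inv g = h" .
qed

lemma mem_conj_set:
  fixes g :: "'a::field mat2"
  assumes "invertible g"
  shows "X \<in> conj_set g S \<longleftrightarrow> matrix_inv g ** X ** g \<in> S"
proof
  assume "X \<in> conj_set g S"
  then obtain A where "A \<in> S" "X = g ** A ** matrix_inv g" by (auto simp: conj_set_def)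
  moreover have "matrix_inv g ** (g ** A ** matrix_inv g) ** g = (matrix_inv g ** g) ** A ** (matrix_inv g ** g)"
    by (simp add: matrix_mul_assoc)
  ultimately show "matrix_inv g ** X ** g \<in> S" using assms by (simp add: matrix_inv_left)
next
  assume "matrix_inv g ** X ** g \<in> S"
  moreover have "g ** (matrix_inv g ** X ** g) ** matrix_inv g = (g ** matrix_inv g) ** X ** (g ** matrix_inv g)"
    by (simp add: matrix_mul_assoc)
  ultimately show "X \<in> conj_set g S"
    using assms by (auto simp: conj_set_def matrix_inv_right intro!: image_eqI[of _ _ "matrix_inv g ** X ** g"])
qed

text \<open>Conjugation by a unipotent matrix that moves the lattice spanned by (p^m, 0) and (a, 1)
  to the one spanned by (p^m, 0) and (0, 1). A condition at the centre \<open>a\<close> thus becomes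
  a condition on the entries of \<open>shear a X\<close>.\<close>

definition shear :: "'a::field \<Rightarrow> 'a mat2 \<Rightarrow> 'a mat2" where
  "shear a X = M2 1 (- a) 0 1 ** X ** M2 1 a 0 1"

lemma shear_M2 [simp]:
  "shear a (M2 x y z w) = M2 (x - a * z) (y + a * (x - w) - a * a * z) z (w + a * z)"
  by (simp add: shear_def algebra_simps)

lemma shear_shear: "shear a (shear b X) = shear (a + b) X"
  and shear_0: "shear 0 X = X"
  and shear_add: "shear a (X + Y) = shear a X + shear a Y"
  and shear_msc: "shear a (msc c X) = msc c (shear a X)"
  and shear_mult: "shear a (X ** Y) = shear a X ** shear a Y"
  and shear_mat: "shear a (mat c) = mat c"
  and shear_zero: "shear a 0 = 0"
  and trace_shear: "trace (shear a X) = trace X"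
  by (cases X rule: M2_cases; cases Y rule: M2_cases; simp add: algebra_simps zero_M2 mat_M2)+

definition comm :: "'a::field mat2 \<Rightarrow> 'a mat2 \<Rightarrow> 'a mat2" where
  "comm X Y = X ** Y - Y ** X"

text \<open>This form is trilinear, alternating, and vanishes when an argument is scalar, so it is a
  determinant on the three-dimensional space of matrices modulo scalars.\<close>

definition triple :: "'a::field mat2 \<Rightarrow> 'a mat2 \<Rightarrow> 'a mat2 \<Rightarrow> 'a" where
  "triple X Y Z = trace (X ** comm Y Z)"

lemma comm_M2 [simp]:
  "comm (M2 a b c d) (M2 a' b' c' d') =
     M2 (b * c' - c * b') (b' * (a - d) - b * (a' - d')) (c * (a' - d') - c' * (a - d)) (c * b' - b * c')"
  by (simp add: comm_def algebra_simps)

lemma triple_cyclic: "triple Y Z X = triple X Y Z"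
  by (cases X rule: M2_cases; cases Y rule: M2_cases; cases Z rule: M2_cases)
     (simp add: triple_def algebra_simps)

lemma trace_comm: "trace (comm X Y) = 0"
  by (cases X rule: M2_cases; cases Y rule: M2_cases) simp

lemma trace_comm_mult:
  "trace (comm Y Z ** X) = triple X Y Z" "trace (comm Y Z ** Y) = 0" "trace (comm Y Z ** Z) = 0"
  by (cases X rule: M2_cases; cases Y rule: M2_cases; cases Z rule: M2_cases;
      simp add: triple_def algebra_simps)+

lemma triple_eq_0: "triple Y Y Z = 0" "triple Z Y Z = 0"
  by (cases Y rule: M2_cases; cases Z rule: M2_cases; simp add: triple_def algebra_simps)+

text \<open>Cramer's rule on matrices modulo scalars; the scalar \<open>s\<close> lost in the
  quotient is read off from a diagonal entry.\<close>

lemma triple_expand: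
  obtains s where "msc (triple X Y Z) W =
    mat s + msc (triple W Y Z) X + msc (triple W Z X) Y + msc (triple W X Y) Z"
proof -
  define V where "V = msc (triple X Y Z) W -
    (msc (triple W Y Z) X + msc (triple W Z X) Y + msc (triple W X Y) Z)"
  have "V = mat (V $ 1 $ 1)"
    by (cases X rule: M2_cases; cases Y rule: M2_cases; cases Z rule: M2_cases; cases W rule: M2_cases)
       (simp add: V_def triple_def mat_M2 algebra_simps)
  then show thesis by (intro that[of "V $ 1 $ 1"]) (simp add: V_def algebra_simps)
qed

text \<open>When \<open>triple X Y Z\<close> is nonzero, the commutators divided by it form the
  basis dual to \<open>X\<close>, \<open>Y\<close>, \<open>Z\<close> under the trace pairing
  (\<open>trace_comm_mult\<close>), and this is the expansion in that basis.\<close>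

lemma triple_expand_traceless:
  assumes "trace W = 0"
  shows "msc (triple X Y Z) W =
    msc (trace (W ** X)) (comm Y Z) + msc (trace (W ** Y)) (comm Z X) + msc (trace (W ** Z)) (comm X Y)"
proof (cases W rule: M2_cases)
  case (M2 a b c d)
  with assms have d: "d = - a" by (simp add: eq_neg_iff_add_eq_0 add.commute)
  show ?thesis unfolding M2 d
    by (cases X rule: M2_cases; cases Y rule: M2_cases; cases Z rule: M2_cases)
       (simp add: triple_def algebra_simps)
qed

text \<open>Modulo scalars, the analogue of the cross product identity (Z \<times> X) \<times> (X
  \<times> Y) = det(X, Y, Z) X. It recovers a basis of an order from the products of its dual
  vectors.\<close>

lemma comm_mult_comm:
  obtains s where "comm Z X ** comm X Y = mat s - msc (triple X Y Z) X"
proof -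
  define V where "V = comm Z X ** comm X Y + msc (triple X Y Z) X"
  have "V = mat (V $ 1 $ 1)"
    by (cases X rule: M2_cases; cases Y rule: M2_cases; cases Z rule: M2_cases)
       (simp add: V_def triple_def mat_M2 algebra_simps)
  then have "comm Z X ** comm X Y = mat (V $ 1 $ 1) - msc (triple X Y Z) X"
    by (metis V_def eq_diff_eq)
  then show thesis by (rule that)
qed

section \<open>Traceless matrices and Cayley-Hamilton identities\<close>

lemma traceless_cases:
  fixes X :: "'a::field mat2"
  assumes "trace X = 0"
  obtains a b c where "X = M2 a b c (- a)"
proof (cases X rule: M2_cases)
  case (M2 a b c d)
  with assms have "d = - a" by (simp add: eq_neg_iff_add_eq_0 add.commute)
  with M2 that show thesis by blast
qed

lemma traceless_square:
  fixes X :: "'a::field mat2"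
  assumes "trace X = 0"
  shows "X ** X = mat (- det X)"
  using assms by (elim traceless_cases) (simp add: mat_M2)

lemma traceless_anticommute:
  fixes X Y :: "'a::field mat2"
  assumes "trace X = 0" "trace Y = 0"
  shows "Y ** X = mat (trace (X ** Y)) - X ** Y"
  using assms by (elim traceless_cases) (simp add: mat_M2 algebra_simps)

text \<open>Anticommuting the inner factors gives the trace times \<open>X\<close> minus
  \<open>X ** X ** Y\<close>, and the square of \<open>X\<close> is - det X.\<close>

lemma traceless_sandwich:
  fixes X Y :: "'a::field mat2"
  assumes "trace X = 0" "trace Y = 0"
  shows "X ** (Y ** X) = msc (trace (X ** Y)) X + msc (det X) Y"
  using assms by (elim traceless_cases) (simp add: algebra_simps)

text \<open>On traceless matrices the trace pairing is minus the polar form of \<open>det\<close>,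
  so values of \<open>det\<close> control the pairings without division by 2.\<close>

lemma traceless_det_add:
  fixes X Y :: "'a::field mat2"
  assumes "trace X = 0" "trace Y = 0"
  shows "det (X + Y) = det X + det Y - trace (X ** Y)"
  using assms by (elim traceless_cases) (simp add: algebra_simps)

lemma mat2_square:
  fixes X :: "'a::field mat2"
  shows "X ** X = msc (trace X) X - mat (det X)"
  by (cases X rule: M2_cases) (simp add: mat_M2 algebra_simps)

text \<open>The polarisation of Cayley-Hamilton.\<close>

lemma mat2_anticommute:
  fixes X Y :: "'a::field mat2"
  shows
  "Y ** X = msc (trace X) Y + msc (trace Y) X + mat (trace (X ** Y) - trace X * trace Y) - X ** Y"
  by (cases X rule: M2_cases; cases Y rule: M2_cases) (simp add: mat_M2 algebra_simps)

lemma det_msc: "det (msc c X) = c * c * det X"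
  and det_mult: "det (X ** Y) = det X * det Y"
  and trace_msc: "trace (msc c X) = c * trace X"
  and trace_mat: "trace (mat c :: 'a mat2) = c + c"
  and trace_mult_mat: "trace (X ** mat c) = c * trace X"
  and mat_mult_right: "X ** mat c = msc c X"
  and msc_mat: "msc c (mat d) = mat (c * d)"
  for X Y :: "'a::field mat2"
  by (cases X rule: M2_cases; cases Y rule: M2_cases; simp add: mat_M2 algebra_simps)+

lemma matrix_mult_distrib:
  fixes X Y Z :: "'a::field mat2"
  shows matrix_mult_add_right: "X ** (Y + Z) = X ** Y + X ** Z"
    and matrix_mult_add_left: "(Y + Z) ** X = Y ** X + Z ** X"
    and matrix_mult_diff_right: "X ** (Y - Z) = X ** Y - X ** Z"
    and matrix_mult_diff_left: "(Y - Z) ** X = Y ** X - Z ** X"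
  by (cases X rule: M2_cases; cases Y rule: M2_cases; cases Z rule: M2_cases; simp add: algebra_simps)+

section \<open>Lattices and orders\<close>

locale valued_field =
  fixes v :: "'a::field \<Rightarrow> int" and p :: 'a
  assumes v_mult: "x \<noteq> 0 \<Longrightarrow> y \<noteq> 0 \<Longrightarrow> v (x * y) = v x + v y"
    and v_add: "x \<noteq> 0 \<Longrightarrow> y \<noteq> 0 \<Longrightarrow> x + y \<noteq> 0 \<Longrightarrow> v (x + y) \<ge> min (v x) (v y)"
    and p_nz [simp]: "p \<noteq> 0" and v_p [simp]: "v p = 1"
begin

section \<open>Valuation balls around 0\<close>

abbreviation B :: "int \<Rightarrow> 'a set" where "B \<equiv> val_ball v"

lemma B_iff: "x \<in> B n \<longleftrightarrow> x = 0 \<or> n \<le> v x"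
  by (simp add: val_ball_def)

lemma v_1 [simp]: "v 1 = 0"
  using v_mult[of 1 1] by simp

lemma v_minus_1 [simp]: "v (- 1) = 0"
  using v_mult[of "-1" "-1"] by simp

lemma v_uminus [simp]: "x \<noteq> 0 \<Longrightarrow> v (- x) = v x"
  using v_mult[of "-1" x] by simp

lemma v_inverse [simp]: "x \<noteq> 0 \<Longrightarrow> v (inverse x) = - v x"
  using v_mult[of x "inverse x"] by simp

lemma v_divide: "x \<noteq> 0 \<Longrightarrow> y \<noteq> 0 \<Longrightarrow> v (x / y) = v x - v y"
  by (simp add: divide_inverse v_mult)

lemma v_power [simp]: "x \<noteq> 0 \<Longrightarrow> v (x ^ n) = int n * v x"
  by (induction n) (simp_all add: v_mult algebra_simps)

lemma v_powi [simp]: "v (p powi n) = n"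
  by (simp add: power_int_def)

lemma B_0 [simp]: "0 \<in> B n"
  and B_1 [simp]: "1 \<in> B 0"
  and B_uminus [simp]: "- x \<in> B n \<longleftrightarrow> x \<in> B n"
  by (cases "x = 0"; simp add: B_iff)+

lemma B_add: "x \<in> B n \<Longrightarrow> y \<in> B n \<Longrightarrow> x + y \<in> B n"
  using v_add[of x y] by (fastforce simp: B_iff)

lemma B_diff: "x \<in> B n \<Longrightarrow> y \<in> B n \<Longrightarrow> x - y \<in> B n"
  using B_add[of x n "- y"] by simp

lemma B_minus_commute: "x - y \<in> B n \<longleftrightarrow> y - x \<in> B n"
  using B_uminus[of "x - y"] by simp

lemma B_mult: "x \<in> B m \<Longrightarrow> y \<in> B n \<Longrightarrow> m + n = k \<Longrightarrow> x * y \<in> B k"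
  by (cases "x = 0"; cases "y = 0") (auto simp: B_iff v_mult)

lemma B_mult0: "x \<in> B 0 \<Longrightarrow> y \<in> B n \<Longrightarrow> x * y \<in> B n"
  by (erule (1) B_mult) simp

lemma B_mono: "x \<in> B n \<Longrightarrow> m \<le> n \<Longrightarrow> x \<in> B m"
  by (auto simp: B_iff)

lemma B_mult_iff: "c \<noteq> 0 \<Longrightarrow> c * x \<in> B n \<longleftrightarrow> x \<in> B (n - v c)"
  by (cases "x = 0") (auto simp: B_iff v_mult)

lemma B_divide_iff: "c \<noteq> 0 \<Longrightarrow> x / c \<in> B n \<longleftrightarrow> x \<in> B (n + v c)"
  by (cases "x = 0") (auto simp: B_iff v_divide)

lemma B_p [simp]: "p powi m \<in> B n \<longleftrightarrow> n \<le> m" "p \<in> B n \<longleftrightarrow> n \<le> 1"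
  by (simp_all add: B_iff)

lemma B_sum: "(\<And>i. i \<in> S \<Longrightarrow> f i \<in> B n) \<Longrightarrow> sum f S \<in> B n"
  by (induction S rule: infinite_finite_induct) (auto intro: B_add)

lemma B_square: "x * x \<in> B n \<longleftrightarrow> x \<in> B ((n + 1) div 2)"
  by (cases "x = 0") (auto simp: B_iff v_mult)

lemma B_exists_common: "finite S \<Longrightarrow> \<exists>n. \<forall>x\<in>S. x \<in> B n"
proof (induction S rule: finite_induct)
  case (insert x S)
  then obtain n where n: "\<forall>x\<in>S. x \<in> B n" by blast
  have "x \<in> B (v x)" by (simp add: B_iff)
  with n have "\<forall>y\<in>insert x S. y \<in> B (min n (v x))"
    using B_mono[of _ n "min n (v x)"] B_mono[of x "v x" "min n (v x)"] by simp
  then show ?case by blast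
qed simp

text \<open>A discrete valuation that is bounded below attains its minimum; subtracting
  \<open>n\<close> turns the values into natural numbers. This is how generators and pivots are
  chosen throughout.\<close>

lemma ex_min_valuation:
  assumes "\<And>x. x \<in> S \<Longrightarrow> x \<in> B n" "z \<in> S" "z \<noteq> 0"
  obtains x where "x \<in> S" "x \<noteq> 0" "\<And>y. y \<in> S \<Longrightarrow> y \<in> B (v x)"
proof -
  obtain x where x: "x \<in> S \<and> x \<noteq> 0" "\<And>y. y \<in> S \<and> y \<noteq> 0 \<Longrightarrow> nat (v x - n) \<le> nat (v y - n)"
    using ex_has_least_nat[of "\<lambda>x. x \<in> S \<and> x \<noteq> 0" z "\<lambda>x. nat (v x - n)"] assms(2,3) by blast
  have "y \<in> B (v x)" if "y \<in> S" for y
    using x(2)[of y] assms(1)[of x] assms(1)[OF that] x(1) that by (cases "y = 0") (auto simp: B_iff)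
  with x(1) show thesis by (intro that) auto
qed

section \<open>Modules over the ring of integers\<close>

definition OK_module :: "'a mat2 set \<Rightarrow> bool" where
  "OK_module M \<longleftrightarrow> 0 \<in> M \<and> (\<forall>x\<in>M. \<forall>y\<in>M. x + y \<in> M) \<and> (\<forall>c\<in>B 0. \<forall>x\<in>M. msc c x \<in> M)"

text \<open>Bounded denominators, which for a module amount to finite generation
  (\<open>fg_OK_module_iff\<close>).\<close>

definition bounded_set :: "'a mat2 set \<Rightarrow> bool" where
  "bounded_set M \<longleftrightarrow> (\<exists>n. \<forall>x\<in>M. \<forall>i j. x$i$j \<in> B n)"

lemma OK_moduleI:
  assumes "0 \<in> M" "\<And>x y. x \<in> M \<Longrightarrow> y \<in> M \<Longrightarrow> x + y \<in> M"
    "\<And>c x. c \<in> B 0 \<Longrightarrow> x \<in> M \<Longrightarrow> msc c x \<in> M"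
  shows "OK_module M"
  using assms by (auto simp: OK_module_def)

lemma OK_moduleD:
  assumes "OK_module M"
  shows OK_module_0: "0 \<in> M"
    and OK_module_add: "x \<in> M \<Longrightarrow> y \<in> M \<Longrightarrow> x + y \<in> M"
    and OK_module_msc: "c \<in> B 0 \<Longrightarrow> x \<in> M \<Longrightarrow> msc c x \<in> M"
    and OK_module_diff: "x \<in> M \<Longrightarrow> y \<in> M \<Longrightarrow> x - y \<in> M"
proof -
  show "x - y \<in> M" if "x \<in> M" "y \<in> M"
  proof -
    have "msc (-1) y \<in> M" using that assms unfolding OK_module_def by (meson B_1 B_uminus)
    then have "x + (- y) \<in> M" using that assms unfolding OK_module_def msc_m1 by blast
    then show ?thesis by simp
  qed
qed (use assms in \<open>auto simp: OK_module_def\<close>)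

lemma OK_module_sum: "OK_module M \<Longrightarrow> (\<And>i. i \<in> S \<Longrightarrow> f i \<in> M) \<Longrightarrow> sum f S \<in> M"
  by (induction S rule: infinite_finite_induct) (auto simp: OK_module_def)

lemma lin_combs_superset: "G \<subseteq> lin_combs (B 0) G"
proof
  fix x assume "x \<in> G"
  then show "x \<in> lin_combs (B 0) G"
    unfolding lin_combs_def by (auto intro!: exI[of _ "{x}"] exI[of _ "\<lambda>_. 1"] simp: msc_1)
qed

lemma lin_combs_minimal:
  assumes "G \<subseteq> M" "OK_module M"
  shows "lin_combs (B 0) G \<subseteq> M"
  using assms by (auto simp: lin_combs_def intro!: OK_module_sum OK_module_msc)

lemma OK_module_lin_combs:
  assumes "finite G"
  shows "OK_module (lin_combs (B 0) G)"
proof -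
  \<comment> \<open>Coefficients outside the chosen subset can be set to 0, so all combinations
    become sums over the whole of \<open>G\<close> and are added coefficientwise.\<close>
  have eq: "lin_combs (B 0) G = {(\<Sum>b\<in>G. msc (c b) b) |c. \<forall>b\<in>G. c b \<in> B 0}"
  proof (intro equalityI subsetI)
    fix x assume "x \<in> lin_combs (B 0) G"
    then obtain F c where F: "finite F" "F \<subseteq> G" "\<forall>b\<in>F. c b \<in> B 0" "x = (\<Sum>b\<in>F. msc (c b) b)"
      by (auto simp: lin_combs_def)
    have "x = (\<Sum>b\<in>G. msc (if b \<in> F then c b else 0) b)"
      unfolding F(4) using F(2) assms by (intro sum.mono_neutral_cong_left) (auto simp: msc_0)
    then show "x \<in> {(\<Sum>b\<in>G. msc (c b) b) |c. \<forall>b\<in>G. c b \<in> B 0}"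
      using F(3) by (intro CollectI exI[of _ "\<lambda>b. if b \<in> F then c b else 0"]) auto
  qed (use assms in \<open>auto simp: lin_combs_def\<close>)
  show ?thesis
    unfolding eq
  proof (rule OK_moduleI)
    show "0 \<in> {(\<Sum>b\<in>G. msc (c b) b) |c. \<forall>b\<in>G. c b \<in> B 0}"
      by (auto intro!: exI[of _ "\<lambda>_. 0"] simp: msc_0)
  next
    fix x y assume "x \<in> {(\<Sum>b\<in>G. msc (c b) b) |c. \<forall>b\<in>G. c b \<in> B 0}"
      "y \<in> {(\<Sum>b\<in>G. msc (c b) b) |c. \<forall>b\<in>G. c b \<in> B 0}"
    then obtain c d where "x = (\<Sum>b\<in>G. msc (c b) b)" "\<forall>b\<in>G. c b \<in> B 0"
      "y = (\<Sum>b\<in>G. msc (d b) b)" "\<forall>b\<in>G. d b \<in> B 0" by auto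
    then show "x + y \<in> {(\<Sum>b\<in>G. msc (c b) b) |c. \<forall>b\<in>G. c b \<in> B 0}"
      by (intro CollectI exI[of _ "\<lambda>b. c b + d b"]) (auto simp: msc_add_left sum.distrib intro: B_add)
  next
    fix k x assume "k \<in> B 0" "x \<in> {(\<Sum>b\<in>G. msc (c b) b) |c. \<forall>b\<in>G. c b \<in> B 0}"
    then obtain c where "x = (\<Sum>b\<in>G. msc (c b) b)" "\<forall>b\<in>G. c b \<in> B 0" "k \<in> B 0" by auto
    then show "msc k x \<in> {(\<Sum>b\<in>G. msc (c b) b) |c. \<forall>b\<in>G. c b \<in> B 0}"
      by (intro CollectI exI[of _ "\<lambda>b. k * c b"]) (auto simp: msc_sum msc_msc intro: B_mult0)
  qed
qed

text \<open>One step of Gaussian elimination: an element whose (i, j) entry has least valuation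
  serves as pivot, and generates \<open>M\<close> together with generators of the kernel of that
  entry.\<close>

lemma fg_OK_module_extend:
  assumes M: "OK_module M" "bounded_set M"
    and fg: "fg_OK_module v {x\<in>M. x$i$j = 0}"
  shows "fg_OK_module v M"
proof (cases "\<exists>x\<in>M. x$i$j \<noteq> 0")
  case False
  then have "{x\<in>M. x$i$j = 0} = M" by auto
  with fg show ?thesis by simp
next
  case True
  obtain n where n: "\<And>x i j. x \<in> M \<Longrightarrow> x$i$j \<in> B n"
    using M(2) by (auto simp: bounded_set_def)
  from True obtain z where z: "z \<in> M" "z$i$j \<noteq> 0" by auto
  obtain c0 where c0: "c0 \<in> (\<lambda>x. x$i$j) ` M" "c0 \<noteq> 0"
      "\<And>c. c \<in> (\<lambda>x. x$i$j) ` M \<Longrightarrow> c \<in> B (v c0)"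
    by (rule ex_min_valuation[of "(\<lambda>x. x$i$j) ` M" n "z$i$j"]) (use n z in auto)
  then obtain y where y: "y \<in> M" "y$i$j \<noteq> 0" and min: "\<And>x. x \<in> M \<Longrightarrow> x$i$j \<in> B (v (y$i$j))"
    by auto
  obtain G where G: "finite G" "{x\<in>M. x$i$j = 0} = lin_combs (B 0) G"
    using fg by (auto simp: fg_OK_module_def)
  have "G \<subseteq> M" using lin_combs_superset[of G] G(2) by blast
  have mod: "OK_module (lin_combs (B 0) (insert y G))"
    by (rule OK_module_lin_combs) (simp add: G)
  have "M = lin_combs (B 0) (insert y G)"
  proof
    show "lin_combs (B 0) (insert y G) \<subseteq> M"
      using \<open>G \<subseteq> M\<close> y(1) M(1) by (intro lin_combs_minimal) auto
    show "M \<subseteq> lin_combs (B 0) (insert y G)"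
    proof
      fix x assume x: "x \<in> M"
      define c where "c = x$i$j / y$i$j"
      have c: "c \<in> B 0"
        using min[OF x] y by (simp add: c_def B_divide_iff)
      have "x - msc c y \<in> {x\<in>M. x$i$j = 0}"
        using x y OK_module_diff[OF M(1) x OK_module_msc[OF M(1) c, of y]]
        by (simp add: c_def msc_def)
      also have "\<dots> \<subseteq> lin_combs (B 0) (insert y G)"
        unfolding G(2) using lin_combs_superset[of "insert y G"] mod by (intro lin_combs_minimal) auto
      finally have "x - msc c y \<in> lin_combs (B 0) (insert y G)" .
      moreover have "msc c y \<in> lin_combs (B 0) (insert y G)"
        using lin_combs_superset[of "insert y G"] by (intro OK_module_msc mod c) auto
      ultimately have "(x - msc c y) + msc c y \<in> lin_combs (B 0) (insert y G)"
        by (intro OK_module_add mod)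
      then show "x \<in> lin_combs (B 0) (insert y G)" by simp
    qed
  qed
  then show ?thesis unfolding fg_OK_module_def using G(1) by blast
qed

text \<open>Finitely many generators have a common bound on their entries. Conversely, the four
  entries are eliminated one after another until only the zero module is left, which the empty set
  generates.\<close>

lemma fg_OK_module_iff: "fg_OK_module v M \<longleftrightarrow> OK_module M \<and> bounded_set M"
proof
  assume "fg_OK_module v M"
  then obtain G where G: "finite G" "M = lin_combs (B 0) G" by (auto simp: fg_OK_module_def)
  have "finite ((\<lambda>(b, i, j). b$i$j) ` (G \<times> UNIV \<times> UNIV))" using G(1) by auto
  from B_exists_common[OF this] obtain n where "\<forall>x\<in>(\<lambda>(b, i, j). b$i$j) ` (G \<times> UNIV \<times> UNIV). x \<in> B n" ..
  then have n: "b$i$j \<in> B n" if "b \<in> G" for b i j using that by force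
  have "bounded_set M"
    unfolding bounded_set_def
  proof (intro exI ballI allI)
    fix x i j assume "x \<in> M"
    then obtain F c where "F \<subseteq> G" "\<forall>b\<in>F. c b \<in> B 0" "x = (\<Sum>b\<in>F. msc (c b) b)"
      by (auto simp: G(2) lin_combs_def)
    then show "x$i$j \<in> B n" using n by (auto simp: msc_def intro!: B_sum B_mult0)
  qed
  then show "OK_module M \<and> bounded_set M" using OK_module_lin_combs G by auto
next
  assume "OK_module M \<and> bounded_set M"
  then have M: "OK_module M" "bounded_set M" by auto
  define N1 where "N1 = {x\<in>M. x$1$1 = 0}"
  define N2 where "N2 = {x\<in>N1. x$1$2 = 0}"
  define N3 where "N3 = {x\<in>N2. x$2$1 = 0}"
  have N1: "OK_module N1" "bounded_set N1"
    using M by (auto simp: N1_def OK_module_def bounded_set_def msc_def)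
  have N2: "OK_module N2" "bounded_set N2"
    using N1 by (auto simp: N2_def OK_module_def bounded_set_def msc_def)
  have N3: "OK_module N3" "bounded_set N3"
    using N2 by (auto simp: N3_def OK_module_def bounded_set_def msc_def)
  have "{x\<in>N3. x$2$2 = 0} = lin_combs (B 0) {}"
    using OK_module_0[OF N3(1)]
    unfolding N3_def N2_def N1_def by (auto simp: mat2_eq_iff[of _ 0] lin_combs_def intro: ccontr) (metis (mono_tags, lifting) mat2_eq_iff zero_index)
  then have "fg_OK_module v {x\<in>N3. x$2$2 = 0}" by (auto simp: fg_OK_module_def)
  then have "fg_OK_module v N3" by (rule fg_OK_module_extend[OF N3])
  then have "fg_OK_module v N2" unfolding N3_def by (rule fg_OK_module_extend[OF N2])
  then have "fg_OK_module v N1" unfolding N2_def by (rule fg_OK_module_extend[OF N1])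
  then show "fg_OK_module v M" unfolding N1_def by (rule fg_OK_module_extend[OF M])
qed

text \<open>The finitely many coefficients of a combination over K have a power of \<open>p\<close>
  as common denominator, and scaling by it lands in \<open>M\<close>.\<close>

lemma spans_A_iff:
  assumes M: "OK_module M"
  shows "spans_A M \<longleftrightarrow> (\<forall>X. \<exists>c. c \<noteq> 0 \<and> msc c X \<in> M)"
proof
  assume sp: "spans_A M"
  show "\<forall>X. \<exists>c. c \<noteq> 0 \<and> msc c X \<in> M"
  proof
    fix X :: "'a mat2"
    have "X \<in> lin_combs UNIV M" using sp by (auto simp: spans_A_def)
    then obtain F c where F: "finite F" "F \<subseteq> M" "X = (\<Sum>b\<in>F. msc (c b) b)"
      by (auto simp: lin_combs_def)
    have "finite (c ` F)" using F(1) by simp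
    from B_exists_common[OF this] obtain n where n: "\<And>b. b \<in> F \<Longrightarrow> c b \<in> B n" by blast
    have "msc (p powi (- n)) X \<in> M"
      unfolding F(3) msc_sum msc_msc
      using F(2) n by (intro OK_module_sum M OK_module_msc) (auto simp: B_mult_iff)
    then show "\<exists>c. c \<noteq> 0 \<and> msc c X \<in> M" by (intro exI[of _ "p powi (- n)"]) simp
  qed
next
  assume ex: "\<forall>X. \<exists>c. c \<noteq> 0 \<and> msc c X \<in> M"
  have "X \<in> lin_combs UNIV M" for X
  proof -
    obtain c where "c \<noteq> 0" "msc c X \<in> M" using ex by blast
    then show ?thesis
      unfolding lin_combs_def
      by (auto intro!: exI[of _ "{msc c X}"] exI[of _ "\<lambda>_. 1 / c"] simp: msc_msc msc_1)
  qed
  then show "spans_A M" by (auto simp: spans_A_def)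
qed

lemma is_order_iff:
  "is_order v R \<longleftrightarrow> mat 1 \<in> R \<and> OK_module R \<and> bounded_set R \<and> (\<forall>x\<in>R. \<forall>y\<in>R. x ** y \<in> R)"
  unfolding is_order_def fg_OK_module_iff
  by (auto intro: OK_module_0 OK_module_add OK_module_diff)

lemma orderD:
  assumes "is_order v R"
  shows order_1: "mat 1 \<in> R" and order_module: "OK_module R" and order_bounded: "bounded_set R"
    and order_mult: "x \<in> R \<Longrightarrow> y \<in> R \<Longrightarrow> x ** y \<in> R"
  using assms by (auto simp: is_order_iff)

end

section \<open>Maximal orders as balls\<close>

context valued_field
begin

text \<open>The maximal order attached to the closed ball \<open>a + p^m O\<close>: the stabiliser of the
  lattice spanned by \<open>(p^m, 0)\<close> and \<open>(a, 1)\<close>.\<close>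

definition ball_order :: "'a \<Rightarrow> int \<Rightarrow> 'a mat2 set" where
  "ball_order a m = {X. shear a X $ 1 $ 1 \<in> B 0 \<and> shear a X $ 1 $ 2 \<in> B m \<and>
                        shear a X $ 2 $ 1 \<in> B (- m) \<and> shear a X $ 2 $ 2 \<in> B 0}"

lemma mem_ball_order:
  "shear a X = M2 x y z w \<Longrightarrow>
     X \<in> ball_order a m \<longleftrightarrow> x \<in> B 0 \<and> y \<in> B m \<and> z \<in> B (- m) \<and> w \<in> B 0"
  by (simp add: ball_order_def)

lemma ball_orderE:
  assumes "X \<in> ball_order a m"
  obtains x y z w where "X = shear (- a) (M2 x y z w)" "shear a X = M2 x y z w"
    "x \<in> B 0" "y \<in> B m" "z \<in> B (- m)" "w \<in> B 0"
proof -
  obtain x y z w where *: "shear a X = M2 x y z w" using M2_cases by blast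
  have "X = shear (- a) (shear a X)" by (simp add: shear_shear shear_0)
  with * assms show thesis by (intro that[of x y z w]) (auto simp: mem_ball_order)
qed

lemma shear_mem_ball_order:
  "shear b (M2 x y z w) \<in> ball_order a m \<longleftrightarrow>
     x - (a + b) * z \<in> B 0 \<and> y + (a + b) * (x - w) - (a + b) * (a + b) * z \<in> B m \<and>
     z \<in> B (- m) \<and> w + (a + b) * z \<in> B 0"
  by (subst mem_ball_order) (simp_all add: shear_shear del: shear_M2, simp_all)

lemma is_order_ball_order: "is_order v (ball_order a m)"
  unfolding is_order_iff
proof (intro conjI ballI)
  show "mat 1 \<in> ball_order a m"
    by (simp add: ball_order_def shear_mat) (simp add: mat_def)
  show "OK_module (ball_order a m)"
  proof (rule OK_moduleI)
    show "0 \<in> ball_order a m" by (simp add: ball_order_def shear_zero)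
  next
    fix X Y assume "X \<in> ball_order a m" "Y \<in> ball_order a m"
    then show "X + Y \<in> ball_order a m" by (simp add: ball_order_def shear_add B_add)
  next
    fix c X assume "c \<in> B 0" "X \<in> ball_order a m"
    then show "msc c X \<in> ball_order a m" by (simp add: ball_order_def shear_msc) (simp add: msc_def B_mult0)
  qed
  show "bounded_set (ball_order a m)"
  proof -
    \<comment> \<open>Undoing the shear multiplies entries by 1, \<open>a\<close> or
      \<open>a * a\<close>, and the sheared entries have valuation at least - \<bar>m\<bar>.\<close>
    obtain n where n: "\<forall>x\<in>{1, a, a * a}. x \<in> B n" using B_exists_common[of "{1, a, a * a}"] by auto
    then have n': "1 \<in> B n" "a \<in> B n" "a * a \<in> B n" by auto
    define k where "k = n - \<bar>m\<bar>"
    have k: "c * x \<in> B k" if "c \<in> B n" "x \<in> B i" "i \<ge> - \<bar>m\<bar>" for c x i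
    proof -
      have "c * x \<in> B (n + i)" using that(1,2) by (rule B_mult) simp
      then show ?thesis by (rule B_mono) (use that(3) k_def in simp)
    qed
    have k1: "x \<in> B k" if "x \<in> B i" "i \<ge> - \<bar>m\<bar>" for x i
      using k[OF n'(1) that] by simp
    show ?thesis unfolding bounded_set_def
    proof (intro exI[of _ k] ballI allI)
      fix X i j assume "X \<in> ball_order a m"
      then obtain x y z w where X: "X = shear (- a) (M2 x y z w)" and
        *: "x \<in> B 0" "y \<in> B m" "z \<in> B (- m)" "w \<in> B 0" by (rule ball_orderE)
      have "x - w \<in> B 0" using * by (intro B_diff)
      then have 1: "a * (x - w) \<in> B k" using n' by (intro k[where i = 0]) auto
      have 2: "a * z \<in> B k" "a * a * z \<in> B k" using n' * by (auto intro!: k[where i = "- m"])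
      have 3: "x \<in> B k" "w \<in> B k" "y \<in> B k" "z \<in> B k"
        using * by (auto intro: k1[where i = 0] k1[where i = m] k1[where i = "- m"])
      show "X $ i $ j \<in> B k"
        using exhaust_2[of i] exhaust_2[of j] 1 2 3 unfolding X
        by (elim disjE) (simp_all add: B_add B_diff)
    qed
  qed
  fix X Y assume X: "X \<in> ball_order a m" and Y: "Y \<in> ball_order a m"
  obtain x y z w where X: "shear a X = M2 x y z w" and
    1: "x \<in> B 0" "y \<in> B m" "z \<in> B (- m)" "w \<in> B 0" using X by (rule ball_orderE)
  obtain x' y' z' w' where Y: "shear a Y = M2 x' y' z' w'" and
    2: "x' \<in> B 0" "y' \<in> B m" "z' \<in> B (- m)" "w' \<in> B 0" using Y by (rule ball_orderE)
  have "shear a (X ** Y) = M2 (x * x' + y * z') (x * y' + y * w') (z * x' + w * z') (z * y' + w * w')"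
    by (simp add: shear_mult X Y)
  then show "X ** Y \<in> ball_order a m"
    using B_mult0[OF 1(1) 2(1)] B_mult[OF 1(2) 2(3), of 0] B_mult0[OF 1(1) 2(2)] B_mult[OF 1(2) 2(4), of m]
      B_mult[OF 1(3) 2(1), of "- m"] B_mult0[OF 1(4) 2(3)] B_mult[OF 1(3) 2(2), of 0] B_mult0[OF 1(4) 2(4)]
    by (simp add: mem_ball_order B_add)
qed

text \<open>An order stabilises the lattice it generates from O^2. In Hermite form this lattice is,
  up to a scalar, the one attached to a ball, and its stabiliser is a
  \<open>ball_order\<close>.\<close>

lemma order_subset_ball_order:
  assumes R: "is_order v R"
  obtains a m where "R \<subseteq> ball_order a m"
proof -
  \<comment> \<open>The lattice R O^2: sums of a first column and a second column of elements of
    \<open>R\<close>.\<close>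
  define L where "L = {(X$1$1 + Y$1$2, X$2$1 + Y$2$2) |X Y. X \<in> R \<and> Y \<in> R}"
  have LI: "(X$1$1 + Y$1$2, X$2$1 + Y$2$2) \<in> L" if "X \<in> R" "Y \<in> R" for X Y
    using that by (auto simp: L_def)
  have L_add: "(x + x', y + y') \<in> L" if "(x, y) \<in> L" "(x', y') \<in> L" for x y x' y'
  proof -
    obtain X Y X' Y' where *: "X \<in> R" "Y \<in> R" "X' \<in> R" "Y' \<in> R"
      "x = X$1$1 + Y$1$2" "y = X$2$1 + Y$2$2" "x' = X'$1$1 + Y'$1$2" "y' = X'$2$1 + Y'$2$2"
      using \<open>(x, y) \<in> L\<close> \<open>(x', y') \<in> L\<close> by (auto simp: L_def)
    show ?thesis using LI[of "X + X'" "Y + Y'"] * OK_module_add[OF order_module[OF R]]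
      by (simp add: algebra_simps)
  qed
  have L_msc: "(c * x, c * y) \<in> L" if "(x, y) \<in> L" "c \<in> B 0" for x y c
  proof -
    obtain X Y where *: "X \<in> R" "Y \<in> R" "x = X$1$1 + Y$1$2" "y = X$2$1 + Y$2$2"
      using \<open>(x, y) \<in> L\<close> by (auto simp: L_def)
    show ?thesis using LI[of "msc c X" "msc c Y"] * that(2) OK_module_msc[OF order_module[OF R]]
      by (simp add: algebra_simps msc_def)
  qed
  have L_mult: "(Z$1$1 * x + Z$1$2 * y, Z$2$1 * x + Z$2$2 * y) \<in> L" if "(x, y) \<in> L" "Z \<in> R" for x y Z
  proof -
    obtain X Y where *: "X \<in> R" "Y \<in> R" "x = X$1$1 + Y$1$2" "y = X$2$1 + Y$2$2"
      using \<open>(x, y) \<in> L\<close> by (auto simp: L_def)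
    have "(Z ** X) $ i $ 1 + (Z ** Y) $ i $ 2 = Z$i$1 * x + Z$i$2 * y" for i
      unfolding * by (simp add: matrix_matrix_mult_def sum_2 algebra_simps)
    then show ?thesis using LI[of "Z ** X" "Z ** Y"] * that(2) order_mult[OF R] by simp
  qed
  obtain n where n: "\<And>X i j. X \<in> R \<Longrightarrow> X$i$j \<in> B n"
    using order_bounded[OF R] by (auto simp: bounded_set_def)
  have L_bounded: "x \<in> B n" "y \<in> B n" if "(x, y) \<in> L" for x y
    using that by (auto simp: L_def intro!: B_add n)
  have "mat 1 \<in> R" "0 \<in> R" using order_1[OF R] OK_module_0[OF order_module[OF R]] by auto
  then have "(1, 0) \<in> L" "(0, 1) \<in> L"
    using LI[of "mat 1" 0] LI[of 0 "mat 1"] by (auto simp: mat_M2)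
  \<comment> \<open>Hermite form: \<open>x1\<close> generates the part of \<open>L\<close> on the
    first axis, and \<open>y2\<close> generates the second coordinates. Dividing (x2, y2) by
    \<open>y2\<close> gives the vector (a, 1).\<close>
  obtain x1 where x1: "(x1, 0) \<in> L" "x1 \<noteq> 0" "\<And>x. (x, 0) \<in> L \<Longrightarrow> x \<in> B (v x1)"
    using ex_min_valuation[of "{x. (x, 0) \<in> L}" n 1] L_bounded(1) \<open>(1, 0) \<in> L\<close>
    by (metis (mono_tags, lifting) mem_Collect_eq zero_neq_one)
  obtain y2 where "y2 \<in> snd ` L" and y2: "y2 \<noteq> 0" "\<And>y. y \<in> snd ` L \<Longrightarrow> y \<in> B (v y2)"
    using ex_min_valuation[of "snd ` L" n 1] L_bounded(2) \<open>(0, 1) \<in> L\<close>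
    by (metis (no_types, lifting) image_iff prod.collapse snd_conv zero_neq_one)
  then obtain x2 where x2: "(x2, y2) \<in> L" by auto
  define a where "a = x2 / y2"
  have *: "y \<in> B (v y2)" "x - a * y \<in> B (v x1)" if "(x, y) \<in> L" for x y
  proof -
    show y: "y \<in> B (v y2)" using y2(2) that by force
    then have "- (y / y2) \<in> B 0" using y2(1) by (simp add: B_divide_iff)
    from L_add[OF that L_msc[OF x2 this]] have "(x - a * y, 0) \<in> L"
      using y2(1) by (simp add: a_def mult.commute)
    then show "x - a * y \<in> B (v x1)" by (rule x1(3))
  qed
  have x2a: "x2 = a * y2" using y2(1) by (simp add: a_def)
  \<comment> \<open>That \<open>Z\<close> maps the two basis vectors into \<open>L\<close> amounts
    to the four entry conditions.\<close>
  have "R \<subseteq> ball_order a (v x1 - v y2)"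
  proof
    fix Z assume Z: "Z \<in> R"
    obtain x y z w where ZM: "Z = M2 x y z w" by (rule M2_cases)
    have "z * x1 \<in> B (v y2)" "(x - a * z) * x1 \<in> B (v x1)"
      using *[OF L_mult[OF x1(1) Z]] by (simp_all add: ZM algebra_simps)
    moreover have "(w + a * z) * y2 \<in> B (v y2)" "(y + a * (x - w) - a * a * z) * y2 \<in> B (v x1)"
      using *[OF L_mult[OF x2 Z]] by (simp_all add: ZM x2a algebra_simps)
    ultimately show "Z \<in> ball_order a (v x1 - v y2)"
      using x1(2) y2(1) by (simp add: ZM ball_order_def mult.commute[of _ x1] mult.commute[of _ y2] B_mult_iff)
  qed
  then show thesis by (rule that)
qed

lemma order_trace: "is_order v R \<Longrightarrow> X \<in> R \<Longrightarrow> trace X \<in> B 0"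
  and order_scalar: "is_order v R \<Longrightarrow> mat c \<in> R \<Longrightarrow> c \<in> B 0"
proof -
  assume R: "is_order v R"
  then obtain a m where am: "R \<subseteq> ball_order a m" by (rule order_subset_ball_order)
  show "trace X \<in> B 0" if "X \<in> R"
  proof -
    from am that have "X \<in> ball_order a m" by blast
    then obtain x y z w where X: "shear a X = M2 x y z w" and
      *: "x \<in> B 0" "y \<in> B m" "z \<in> B (- m)" "w \<in> B 0" by (rule ball_orderE)
    have "trace X = x + w" using trace_shear[of a X] by (simp add: X)
    then show "trace X \<in> B 0" using * by (simp add: B_add)
  qed
  show "c \<in> B 0" if "mat c \<in> R"
    using subsetD[OF am that] by (simp add: ball_order_def shear_mat) (simp add: mat_def)
qed

lemma ball_order_cong:
  assumes "a - b \<in> B m"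
  shows "ball_order a m = ball_order b m"
proof -
  have "ball_order a m \<subseteq> ball_order b m" if "a - b \<in> B m" for a b
  proof
    fix X assume "X \<in> ball_order a m"
    then obtain x y z w where X: "X = shear (- a) (M2 x y z w)" and
      *: "x \<in> B 0" "y \<in> B m" "z \<in> B (- m)" "w \<in> B 0" by (rule ball_orderE)
    define d where "d = b - a"
    have d: "d \<in> B m" using that by (simp add: d_def B_minus_commute)
    have dz: "d * z \<in> B 0" using d *(3) by (rule B_mult) simp
    have "(x - w) * d \<in> B m" "(d * z) * d \<in> B m" using * d dz by (auto intro!: B_mult0 B_diff)
    then have "d * (x - w) \<in> B m" "d * d * z \<in> B m" by (simp_all add: mult_ac)
    then show "X \<in> ball_order b m"
      using * dz unfolding X shear_mem_ball_order by (simp add: d_def[symmetric] B_add B_diff)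
  qed
  from this[OF assms] this[of b a] show ?thesis using assms B_minus_commute[of a b] by blast
qed

text \<open>The hypothesis is tested on the two off-diagonal matrix units, scaled and carried to the
  centre \<open>a\<close>. Recentring the second one at \<open>b\<close> produces the square of b -
  a, hence the halved exponent. The case c = 1 describes inclusions, c = p adjacency.\<close>

lemma scaled_ball_order_subset:
  assumes c: "c \<noteq> 0" and sub: "\<And>X. X \<in> ball_order a m \<Longrightarrow> msc c X \<in> ball_order b l"
  shows "l \<le> m + v c" "m \<le> l + v c" "a - b \<in> B ((l + m - v c + 1) div 2)"
proof -
  define d where "d = b - a"
  have "shear (- a) (M2 0 (p powi m) 0 0) \<in> ball_order a m"
    "shear (- a) (M2 0 0 (p powi (- m)) 0) \<in> ball_order a m"
    unfolding shear_mem_ball_order by simp_all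
  from this[THEN sub]
  have "c * p powi m \<in> B l" "c * p powi (- m) \<in> B (- l)" "d * d * (c * p powi (- m)) \<in> B l"
    unfolding shear_msc[symmetric] M2_msc shear_mem_ball_order by (simp_all add: d_def)
  then have *: "l - v c \<le> m" "- l - v c \<le> - m" "(c * p powi (- m)) * (d * d) \<in> B l"
    using c by (simp_all add: B_mult_iff mult.commute del: power_int_minus)
  moreover have "v (c * p powi (- m)) = v c - m" using c by (simp add: v_mult)
  moreover have "c * p powi (- m) \<noteq> 0" using c by simp
  ultimately have "d * d \<in> B (l - (v c - m))" using B_mult_iff[of "c * p powi (- m)" "d * d" l] by simp
  then have "d \<in> B ((l - (v c - m) + 1) div 2)" by (simp only: B_square)
  then show "a - b \<in> B ((l + m - v c + 1) div 2)"
    using B_minus_commute[of a b] by (simp add: d_def algebra_simps)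
  show "l \<le> m + v c" "m \<le> l + v c" using * by simp_all
qed

text \<open>Since (2 * m + 1) div 2 is \<open>m\<close>, an inclusion already forces equality; this
  is what makes these orders maximal.\<close>

lemma ball_order_subset_iff:
  "ball_order a m \<subseteq> ball_order b l \<longleftrightarrow> m = l \<and> a - b \<in> B m"
proof
  assume "ball_order a m \<subseteq> ball_order b l"
  then have "\<And>X. X \<in> ball_order a m \<Longrightarrow> msc 1 X \<in> ball_order b l" by (auto simp: msc_1)
  note scaled_ball_order_subset[OF _ this]
  then have "m \<le> l" "l \<le> m" "a - b \<in> B ((l + m + 1) div 2)" by simp_all
  then show "m = l \<and> a - b \<in> B m" by simp
qed (use ball_order_cong in blast)

lemma ball_order_eq_iff: "ball_order a m = ball_order b l \<longleftrightarrow> m = l \<and> a - b \<in> B m"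
  using ball_order_subset_iff[of a m b l] ball_order_cong by blast

lemma maximal_order_iff: "maximal_order v D \<longleftrightarrow> (\<exists>a m. D = ball_order a m)"
proof
  assume D: "maximal_order v D"
  then obtain a m where "D \<subseteq> ball_order a m"
    by (auto simp: maximal_order_def elim: order_subset_ball_order)
  then show "\<exists>a m. D = ball_order a m"
    using D is_order_ball_order[of a m] by (auto simp: maximal_order_def)
next
  assume "\<exists>a m. D = ball_order a m"
  then obtain a m where D: "D = ball_order a m" by blast
  show "maximal_order v D"
    unfolding maximal_order_def D
  proof (intro conjI allI impI is_order_ball_order, elim conjE)
    fix R assume R: "is_order v R" "ball_order a m \<subseteq> R"
    obtain b l where bl: "R \<subseteq> ball_order b l" using R(1) by (rule order_subset_ball_order)
    with R(2) have "ball_order a m \<subseteq> ball_order b l" by blast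
    then have "ball_order b l = ball_order a m"
      using ball_order_subset_iff[of a m b l] ball_order_eq_iff[of a m b l] by blast
    with R(2) bl show "R = ball_order a m" by blast
  qed
qed

text \<open>Convexity of branches: the path in the tree climbs from the first ball to the smallest
  ball containing both, and the conditions on \<open>j\<close> put \<open>ball_order a j\<close> on
  this climb. Only the lower left entry \<open>z\<close> needs work: it is bounded either by
  \<open>l\<close> directly, or because (b - a) * z is a difference of two integral diagonal
  entries.\<close>

lemma ball_order_between:
  assumes "X \<in> ball_order a m" "X \<in> ball_order b l" "j \<le> m" "l \<le> j \<or> a - b \<notin> B (j + 1)"
  shows "X \<in> ball_order a j"
proof -
  obtain x y z w where X: "X = shear (- a) (M2 x y z w)" and
    *: "x \<in> B 0" "y \<in> B m" "z \<in> B (- m)" "w \<in> B 0" using assms(1) by (rule ball_orderE)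
  define d where "d = b - a"
  have z: "z \<in> B (- l)" and xz: "x - d * z \<in> B 0"
    using assms(2) unfolding X shear_mem_ball_order by (auto simp: d_def)
  have "z \<in> B (- j)"
  proof (cases "l \<le> j")
    case True
    with z show ?thesis by (auto intro: B_mono)
  next
    case False
    then have "d \<notin> B (j + 1)" using assms(4) by (simp add: d_def B_minus_commute)
    then have d: "d \<noteq> 0" "v d \<le> j" by (auto simp: B_iff)
    have "d * z \<in> B 0" using B_diff[OF *(1) xz] by simp
    then have "z \<in> B (- v d)" using d by (simp add: B_mult_iff)
    then show ?thesis using d by (auto intro: B_mono)
  qed
  moreover have "y \<in> B j" using *(2) assms(3) by (rule B_mono)
  ultimately show ?thesis using * unfolding X shear_mem_ball_order by simp
qed

section \<open>Adjacency in terms of balls\<close>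

lemma conj_std:
  fixes a m
  defines "g \<equiv> M2 (p powi m) a 0 1"
  shows "invertible g" "conj_set g (std_max v) = ball_order a m"
    "conj_set g (std_nbr v) = ball_order a (m - 1)"
proof -
  define q where "q = p powi (- m)"
  have q: "p powi m * q = 1" by (simp add: q_def power_int_minus)
  have "g ** M2 q (- a * q) 0 1 = mat 1"
    using q by (simp add: g_def mat_M2 algebra_simps)
  note inv = matrix_inv_unique[OF this]
  show "invertible g" by fact
  have *: "matrix_inv g ** X ** g = M2 (shear a X $ 1 $ 1) (q * shear a X $ 1 $ 2)
      (p powi m * shear a X $ 2 $ 1) (shear a X $ 2 $ 2)" for X
  proof (cases X rule: M2_cases)
    case (M2 x y z w)
    have "(q * x - a * q * z) * p powi m = x - a * z"
      using q by algebra
    then show ?thesis unfolding M2 inv(2) unfolding g_def by (simp add: algebra_simps)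
  qed
  have q': "q \<noteq> 0" "v q = - m" unfolding q_def v_powi by (rule power_int_not_zero) simp_all
  show "conj_set g (std_max v) = ball_order a m"
    by (auto simp: mem_conj_set[OF inv(1)] * q' std_max_def forall_2 ball_order_def B_mult_iff)
  show "conj_set g (std_nbr v) = ball_order a (m - 1)"
    by (auto simp: mem_conj_set[OF inv(1)] * q' std_nbr_def ball_order_def B_mult_iff)
qed

text \<open>Consequences of adjacency that no longer mention the base change \<open>g\<close>, yet
  suffice to recognise adjacent balls.\<close>

lemma bt_adj_imp:
  assumes "bt_adj v D1 D2"
  shows "D1 \<noteq> D2" "X \<in> D1 \<Longrightarrow> msc p X \<in> D2" "X \<in> D2 \<Longrightarrow> msc p X \<in> D1"
proof -
  obtain g where g: "invertible g" and D:
     "(D1 = conj_set g (std_max v) \<and> D2 = conj_set g (std_nbr v)) \<or>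
      (D2 = conj_set g (std_max v) \<and> D1 = conj_set g (std_nbr v))"
    using assms by (auto simp: bt_adj_def)
  have 1: "msc p Y \<in> std_nbr v" if "Y \<in> std_max v" for Y
    using that by (auto simp: std_nbr_def std_max_def msc_def B_mult_iff forall_2 intro: B_mono)
  have 2: "msc p Y \<in> std_max v" if "Y \<in> std_nbr v" for Y
    using that by (auto simp: std_nbr_def std_max_def msc_def B_mult_iff forall_2 intro: B_mono)
  show "X \<in> D1 \<Longrightarrow> msc p X \<in> D2" "X \<in> D2 \<Longrightarrow> msc p X \<in> D1"
    using D 1 2 by (auto simp: mem_conj_set[OF g] msc_mult_left msc_mult_right)
  \<comment> \<open>The lower left matrix unit separates the two standard orders, and its conjugate
    separates \<open>D1\<close> from \<open>D2\<close>.\<close>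
  have "M2 0 0 1 0 \<in> std_max v" "M2 0 0 1 0 \<notin> std_nbr v"
    by (auto simp: std_max_def std_nbr_def forall_2 B_iff)
  moreover define Y where "Y = g ** M2 0 0 1 0 ** matrix_inv g"
  have "matrix_inv g ** Y ** g = (matrix_inv g ** g) ** M2 0 0 1 0 ** (matrix_inv g ** g)"
    by (simp add: Y_def matrix_mul_assoc)
  then have "matrix_inv g ** Y ** g = M2 0 0 1 0" using g by (simp add: matrix_inv_left)
  ultimately have "Y \<in> conj_set g (std_max v)" "Y \<notin> conj_set g (std_nbr v)"
    by (auto simp: mem_conj_set[OF g])
  with D show "D1 \<noteq> D2" by auto
qed

text \<open>As p D1 lies in D2, the indices differ by at most 1 and a - b has valuation at least (l
  + m) div 2, which is then the smaller index. Equal indices would make the two orders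
  equal.\<close>

lemma bt_adj_ball_order_iff:
  "bt_adj v (ball_order a m) (ball_order b l) \<longleftrightarrow> \<bar>m - l\<bar> = 1 \<and> a - b \<in> B (min m l)"
proof
  assume adj: "bt_adj v (ball_order a m) (ball_order b l)"
  note scaled_ball_order_subset[OF p_nz bt_adj_imp(2)[OF adj]]
  then have "l \<le> m + 1" "m \<le> l + 1" and d: "a - b \<in> B ((l + m) div 2)"
    by simp_all
  then consider "l = m" | "l = m + 1" | "l = m - 1" by linarith
  then show "\<bar>m - l\<bar> = 1 \<and> a - b \<in> B (min m l)"
  proof cases
    case 1
    with d have "ball_order a m = ball_order b l" by (simp add: ball_order_eq_iff)
    with bt_adj_imp(1)[OF adj] show ?thesis by simp
  next
    case 2
    then have "(l + m) div 2 = m" by simp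
    with 2 d show ?thesis by (simp add: min_def)
  next
    case 3
    then have "(l + m) div 2 = l" by linarith
    with 3 d show ?thesis by (simp add: min_def)
  qed
next
  have nbr: "bt_adj v (ball_order a m) (ball_order a (m - 1))"
            "bt_adj v (ball_order a (m - 1)) (ball_order a m)" for a m
    using conj_std[of m a] unfolding bt_adj_def maximal_order_iff by blast+
  assume *: "\<bar>m - l\<bar> = 1 \<and> a - b \<in> B (min m l)"
  then consider "l = m - 1" | "m = l - 1" by linarith
  then show "bt_adj v (ball_order a m) (ball_order b l)"
  proof cases
    case 1
    with * have "ball_order b l = ball_order a (m - 1)"
      by (simp add: ball_order_eq_iff B_minus_commute min_def)
    then show ?thesis using nbr by simp
  next
    case 2
    with * have "ball_order a m = ball_order b (l - 1)"
      by (simp add: ball_order_eq_iff min_def)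
    then show ?thesis using nbr by simp
  qed
qed

end

section \<open>The orders \<open>O + pD\<close> and lines\<close>

context valued_field
begin

text \<open>The order \<open>O + p D\<close>, where \<open>D = ball_order a m\<close>.\<close>

definition ball_suborder :: "'a \<Rightarrow> int \<Rightarrow> 'a mat2 set" where
  "ball_suborder a m = {X. shear a X $ 1 $ 1 \<in> B 0 \<and> shear a X $ 2 $ 2 \<in> B 0 \<and>
      shear a X $ 1 $ 1 - shear a X $ 2 $ 2 \<in> B 1 \<and>
      shear a X $ 1 $ 2 \<in> B (m + 1) \<and> shear a X $ 2 $ 1 \<in> B (1 - m)}"

lemma mem_ball_suborder:
  "shear a X = M2 x y z w \<Longrightarrow> X \<in> ball_suborder a m \<longleftrightarrow>
     x \<in> B 0 \<and> w \<in> B 0 \<and> x - w \<in> B 1 \<and> y \<in> B (m + 1) \<and> z \<in> B (1 - m)"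
  by (simp add: ball_suborder_def)

lemma shear_uminus_mem_ball_suborder:
  "shear (- a) (M2 x y z w) \<in> ball_suborder a m \<longleftrightarrow>
     x \<in> B 0 \<and> w \<in> B 0 \<and> x - w \<in> B 1 \<and> y \<in> B (m + 1) \<and> z \<in> B (1 - m)"
  by (rule mem_ball_suborder) (simp add: shear_shear shear_0 del: shear_M2)

lemma ball_suborder_subset: "ball_suborder a m \<subseteq> ball_order a m"
  by (auto simp: ball_suborder_def ball_order_def intro: B_mono)

lemma ball_suborderE:
  assumes "X \<in> ball_suborder a m"
  obtains x y z w where "X = shear (- a) (M2 x y z w)" "shear a X = M2 x y z w"
    "x \<in> B 0" "w \<in> B 0" "x - w \<in> B 1" "y \<in> B (m + 1)" "z \<in> B (1 - m)"
proof -
  have "X \<in> ball_order a m" using assms ball_suborder_subset by blast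
  then obtain x y z w where X: "X = shear (- a) (M2 x y z w)" "shear a X = M2 x y z w"
    by (rule ball_orderE)
  from X(2) assms show thesis by (intro that[OF X]) (simp_all add: mem_ball_suborder)
qed

lemma OK_module_ball_suborder: "OK_module (ball_suborder a m)"
proof (rule OK_moduleI)
  show "0 \<in> ball_suborder a m" by (simp add: ball_suborder_def shear_zero)
next
  fix X Y assume "X \<in> ball_suborder a m" "Y \<in> ball_suborder a m"
  then show "X + Y \<in> ball_suborder a m" by (simp add: ball_suborder_def shear_add B_add add_diff_add)
next
  fix c X assume "c \<in> B 0" "X \<in> ball_suborder a m"
  then show "msc c X \<in> ball_suborder a m"
    by (simp add: ball_suborder_def shear_msc) (simp add: msc_def B_mult0 flip: right_diff_distrib)
qed

lemma mat_mem_ball_suborder: "c \<in> B 0 \<Longrightarrow> mat c \<in> ball_suborder a m"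
  by (simp add: ball_suborder_def shear_mat) (simp add: mat_def)

lemma msc_p_mem_ball_suborder: "X \<in> ball_order a m \<Longrightarrow> msc p X \<in> ball_suborder a m"
  by (simp add: ball_suborder_def ball_order_def shear_msc)
     (auto simp: msc_def B_mult_iff right_diff_distrib[symmetric] intro: B_mono B_diff)

lemma is_order_ball_suborder: "is_order v (ball_suborder a m)"
  unfolding is_order_iff
proof (intro conjI ballI OK_module_ball_suborder mat_mem_ball_suborder B_1)
  show "bounded_set (ball_suborder a m)"
    using ball_suborder_subset[of a m] order_bounded[OF is_order_ball_order[of a m]]
    unfolding bounded_set_def by blast
  fix X Y assume X: "X \<in> ball_suborder a m" and Y: "Y \<in> ball_suborder a m"
  obtain x y z w where X: "shear a X = M2 x y z w" and
    1: "x \<in> B 0" "w \<in> B 0" "x - w \<in> B 1" "y \<in> B (m + 1)" "z \<in> B (1 - m)"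
    using X by (rule ball_suborderE)
  obtain x' y' z' w' where Y: "shear a Y = M2 x' y' z' w'" and
    2: "x' \<in> B 0" "w' \<in> B 0" "x' - w' \<in> B 1" "y' \<in> B (m + 1)" "z' \<in> B (1 - m)"
    using Y by (rule ball_suborderE)
  have yz: "y * z' \<in> B 1" "z * y' \<in> B 1"
    using B_mult[OF 1(4) 2(5), of 2] B_mult[OF 1(5) 2(4), of 2] by (auto intro: B_mono)
  have "x * x' + y * z' - (z * y' + w * w') = x * (x' - w') + (x - w) * w' + y * z' - z * y'"
    by (simp add: algebra_simps)
  also have "\<dots> \<in> B 1"
    using yz B_mult0[OF 1(1) 2(3)] B_mult[OF 1(3) 2(2), of 1] by (intro B_add B_diff) auto
  finally have "x * x' + y * z' - (z * y' + w * w') \<in> B 1" .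
  then show "X ** Y \<in> ball_suborder a m"
    using yz[THEN B_mono, of 0] B_mult0[OF 1(1) 2(1)] B_mult0[OF 1(1) 2(4)] B_mult[OF 1(4) 2(2), of "m + 1"]
      B_mult[OF 1(5) 2(1), of "1 - m"] B_mult0[OF 1(2) 2(5)] B_mult0[OF 1(2) 2(2)]
    by (simp add: ball_suborder_def shear_mult X Y B_add)
qed

section \<open>The neighbours of D and the order O + pD\<close>

lemma ball_suborder_subset_parent: "ball_suborder a m \<subseteq> ball_order a (m - 1)"
  by (auto simp: ball_suborder_def ball_order_def intro: B_mono)

text \<open>Recentring by d = b - a adds d * (x - w) and subtracts d * d * z in the upper right
  corner. Both gain a factor \<open>p\<close>, because \<open>x - w\<close> is divisible by
  \<open>p\<close> and \<open>z\<close> lies in \<open>B (1 - m)\<close>.\<close>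

lemma ball_suborder_subset_child:
  assumes "a - b \<in> B m"
  shows "ball_suborder a m \<subseteq> ball_order b (m + 1)"
proof
  fix X assume "X \<in> ball_suborder a m"
  then obtain x y z w where X: "X = shear (- a) (M2 x y z w)" and
    *: "x \<in> B 0" "w \<in> B 0" "x - w \<in> B 1" "y \<in> B (m + 1)" "z \<in> B (1 - m)"
    by (rule ball_suborderE)
  define d where "d = b - a"
  have d: "d \<in> B m" using assms B_minus_commute[of a b] by (simp add: d_def)
  have dz: "d * z \<in> B 1" using d *(5) by (rule B_mult) simp
  have "d * (x - w) \<in> B (m + 1)" using d *(3) by (rule B_mult) simp
  moreover have "d * d * z \<in> B (m + 1)" unfolding mult.assoc using d dz by (rule B_mult) simp
  moreover have "z \<in> B (- (m + 1))" using *(5) by (rule B_mono) simp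
  moreover have "d * z \<in> B 0" using dz by (rule B_mono) simp
  ultimately show "X \<in> ball_order b (m + 1)"
    using * unfolding X shear_mem_ball_order by (simp add: d_def[symmetric] B_add B_diff)
qed

text \<open>The parent bounds \<open>z\<close>. Comparing the upper right entries at the two
  children bounds d * (x - w), where d = b - a has valuation exactly \<open>k\<close>.\<close>

lemma mem_ball_suborder_parent_children:
  assumes X: "X \<in> ball_order a (k + 1)" "X \<in> ball_order a (k - 1)" "X \<in> ball_order b (k + 1)"
    and ab: "a - b \<in> B k" "a - b \<notin> B (k + 1)"
  shows "X \<in> ball_suborder a k"
proof -
  obtain x y z w where XM: "X = shear (- a) (M2 x y z w)" and
    *: "x \<in> B 0" "y \<in> B (k + 1)" "z \<in> B (- (k + 1))" "w \<in> B 0" using X(1) by (rule ball_orderE)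
  define d where "d = b - a"
  have d: "d \<noteq> 0" "v d = k" "d \<in> B k"
    using ab B_minus_commute[of a b] by (auto simp: B_iff d_def)
  have z: "z \<in> B (1 - k)" using X(2) unfolding XM shear_mem_ball_order by simp
  have "y + d * (x - w) - d * d * z \<in> B (k + 1)"
    using X(3) unfolding XM shear_mem_ball_order by (simp add: d_def)
  moreover have "d * d * z \<in> B (k + 1)"
    using B_mult[OF d(3) B_mult[OF d(3) z refl]] by (simp add: mult.assoc)
  ultimately have "(y + d * (x - w) - d * d * z) + d * d * z - y \<in> B (k + 1)"
    by (intro B_diff[OF B_add *(2)])
  then have "d * (x - w) \<in> B (k + 1)" by simp
  then have "x - w \<in> B 1" using d by (simp add: B_mult_iff)
  then show ?thesis using * z unfolding XM shear_uminus_mem_ball_suborder by simp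
qed

text \<open>Each further child makes x - w - d * z divisible by \<open>p\<close>, with
  \<open>d\<close> the difference of the centres. Subtracting the two relations bounds (b - c) * z
  and hence \<open>z\<close>, after which either relation bounds \<open>x - w\<close>.\<close>

lemma mem_ball_suborder_three_children:
  assumes X: "X \<in> ball_order a (k + 1)" "X \<in> ball_order b (k + 1)" "X \<in> ball_order c (k + 1)"
    and ab: "a - b \<in> B k" "a - b \<notin> B (k + 1)"
    and ac: "a - c \<in> B k" "a - c \<notin> B (k + 1)"
    and bc: "b - c \<notin> B (k + 1)"
  shows "X \<in> ball_suborder a k"
proof -
  obtain x y z w where XM: "X = shear (- a) (M2 x y z w)" and
    *: "x \<in> B 0" "y \<in> B (k + 1)" "z \<in> B (- (k + 1))" "w \<in> B 0" using X(1) by (rule ball_orderE)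
  have diff: "z \<in> B (- k) \<and> x - w - (b - a) * z \<in> B 1"
    if "X \<in> ball_order b (k + 1)" "a - b \<in> B k" "a - b \<notin> B (k + 1)" for b
  proof -
    define d where "d = b - a"
    have d: "d \<noteq> 0" "v d = k"
      using that(2,3) B_minus_commute[of a b] by (auto simp: B_iff d_def)
    have "x - d * z \<in> B 0" and q: "y + d * (x - w) - d * d * z \<in> B (k + 1)"
      using that(1) unfolding XM shear_mem_ball_order by (simp_all add: d_def)
    from B_diff[OF *(1) this(1)] have "z \<in> B (- k)" using d by (simp add: B_mult_iff)
    moreover have "d * (x - w - d * z) \<in> B (k + 1)"
      using B_diff[OF q *(2)] by (simp add: algebra_simps)
    then have "x - w - d * z \<in> B 1" using d by (simp add: B_mult_iff)
    ultimately show ?thesis by (simp add: d_def)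
  qed
  have "b - c \<noteq> 0" "v (b - c) \<le> k" using bc by (auto simp: B_iff)
  moreover have "(b - c) * z \<in> B 1"
    using B_diff[OF diff[OF X(3) ac, THEN conjunct2] diff[OF X(2) ab, THEN conjunct2]]
    by (simp add: algebra_simps)
  ultimately have z: "z \<in> B (1 - k)" by (auto simp: B_mult_iff intro: B_mono)
  have "(b - a) * z \<in> B 1"
    using ab(1) z B_minus_commute[of a b] by (intro B_mult[of _ k _ "1 - k"]) auto
  from B_add[OF diff[OF X(2) ab, THEN conjunct2] this] have "x - w \<in> B 1" by simp
  then show ?thesis using * z unfolding XM shear_uminus_mem_ball_suborder by simp
qed

section \<open>O + pD is not Gorenstein\<close>

lemma shear_sum: "shear a (\<Sum>k\<in>F. f k) = (\<Sum>k\<in>F. shear a (f k))"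
  by (induction F rule: infinite_finite_induct) (simp_all add: shear_add shear_zero)

lemma trace_mult_shear: "trace (shear (- a) X ** Y) = trace (X ** shear a Y)"
proof -
  have "shear a (shear (- a) X ** Y) = X ** shear a Y" by (simp add: shear_mult shear_shear shear_0)
  then show ?thesis by (metis trace_shear)
qed

text \<open>The codifferent contains such large off-diagonal elements that every \<open>J\<close>
  with product in the order has small entries. The upper left entry of each product is then
  divisible by \<open>p\<close>, so 1 is not a sum of products.\<close>

lemma not_gorenstein_ball_suborder: "\<not> gorenstein v (ball_suborder a m)"
proof
  let ?R = "ball_suborder a m"
  let ?C = "codifferent v ?R"
  assume "gorenstein v ?R"
  then obtain J where J: "set_mult ?C J = ?R"
    by (auto simp: gorenstein_def invertible_ideal_def)
  then have "mat 1 \<in> set_mult ?C J" by (simp add: mat_mem_ball_suborder)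
  then obtain F f g where F: "finite (F::nat set)" "\<And>k. k \<in> F \<Longrightarrow> f k \<in> ?C" "\<And>k. k \<in> F \<Longrightarrow> g k \<in> J"
      "mat 1 = (\<Sum>k\<in>F. f k ** g k)"
    by (auto simp: set_mult_def)
  have J_mult: "X ** Y \<in> ?R" if "X \<in> ?C" "Y \<in> J" for X Y
  proof -
    have "X ** Y \<in> set_mult ?C J"
      unfolding set_mult_def using that
      by (intro CollectI exI[of _ "{0}"] exI[of _ "\<lambda>_. X"] exI[of _ "\<lambda>_. Y"]) auto
    then show ?thesis by (simp add: J)
  qed
  have C12: "shear (- a) (M2 0 (p powi (m - 1)) 0 0) \<in> ?C"
    and C21: "shear (- a) (M2 0 0 (p powi (- m - 1)) 0) \<in> ?C"
    by (auto simp: codifferent_def trace_mult_shear B_mult_iff add.commute elim!: ball_suborderE simp del: shear_M2)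
  have J_small: "shear a Y $ 1 $ 1 \<in> B 2 \<and> shear a Y $ 2 $ 1 \<in> B (2 - m)" if "Y \<in> J" for Y
  proof -
    obtain x y z w where Y: "shear a Y = M2 x y z w" by (rule M2_cases)
    have YY: "Y = shear (- a) (M2 x y z w)" unfolding Y[symmetric] by (simp add: shear_shear shear_0)
    from J_mult[OF C12 that] J_mult[OF C21 that] show ?thesis
      unfolding YY shear_mult[symmetric] M2_mult shear_uminus_mem_ball_suborder
      by (simp add: shear_shear shear_0 B_mult_iff del: shear_M2)
  qed
  \<comment> \<open>Bounds in the other direction, from pairing with two elements of O + pD.\<close>
  have C_small: "shear a X $ 1 $ 1 \<in> B (- 1) \<and> shear a X $ 1 $ 2 \<in> B (m - 1)" if "X \<in> ?C" for X
  proof -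
    obtain x y z w where X: "shear a X = M2 x y z w" by (rule M2_cases)
    have tr: "trace (shear (- a) Y ** X) \<in> B 0" if "shear (- a) Y \<in> ?R" for Y
      using \<open>X \<in> ?C\<close> that by (simp add: codifferent_def trace_mul_sym[of X])
    from tr[of "M2 p 0 0 0"] tr[of "M2 0 0 (p powi (1 - m)) 0"] show ?thesis
      by (simp add: shear_uminus_mem_ball_suborder trace_mult_shear X B_mult_iff del: shear_M2)
  qed
  have "shear a (f k ** g k) $ 1 $ 1 \<in> B 1" if k: "k \<in> F" for k
  proof -
    have "shear a (f k ** g k) $ 1 $ 1 =
        shear a (f k) $ 1 $ 1 * shear a (g k) $ 1 $ 1 + shear a (f k) $ 1 $ 2 * shear a (g k) $ 2 $ 1"
      unfolding shear_mult by (simp add: matrix_matrix_mult_def sum_2)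
    moreover have "shear a (f k) $ 1 $ 1 * shear a (g k) $ 1 $ 1 \<in> B 1"
      using C_small[OF F(2)[OF k]] J_small[OF F(3)[OF k]] by (intro B_mult[of _ "- 1" _ 2]) auto
    moreover have "shear a (f k) $ 1 $ 2 * shear a (g k) $ 2 $ 1 \<in> B 1"
      using C_small[OF F(2)[OF k]] J_small[OF F(3)[OF k]] by (intro B_mult[of _ "m - 1" _ "2 - m"]) auto
    ultimately show ?thesis by (simp add: B_add)
  qed
  then have "shear a (\<Sum>k\<in>F. f k ** g k) $ 1 $ 1 \<in> B 1"
    by (simp add: shear_sum B_sum)
  then have "shear a (mat 1) $ 1 $ 1 \<in> B 1" unfolding F(4) .
  then show False by (simp add: shear_mat) (simp add: mat_def B_iff)
qed

section \<open>The shape of branches\<close>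

lemma full_order_superset:
  assumes "full_order v H" "is_order v R" "H \<subseteq> R"
  shows "full_order v R"
proof -
  have "OK_module H" "spans_A H" using assms(1) by (auto simp: full_order_def order_module)
  then have "\<forall>X. \<exists>c. c \<noteq> 0 \<and> msc c X \<in> H" by (simp add: spans_A_iff)
  with assms(3) have "\<forall>X. \<exists>c. c \<noteq> 0 \<and> msc c X \<in> R" by blast
  with assms(2) show ?thesis by (simp add: full_order_def spans_A_iff order_module)
qed

lemma full_order_scale:
  assumes "full_order v H"
  obtains c where "c \<noteq> 0" "msc c X \<in> H"
  using assms spans_A_iff[OF order_module] by (auto simp: full_order_def)

text \<open>The branch contains D with three distinct neighbours, whereas a vertex of a line has at
  most two.\<close>

lemma not_line_of_subset_ball_suborder:
  assumes "H \<subseteq> ball_suborder a m"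
  shows "\<not> is_line (branch v H) (bt_adj v)"
proof
  assume "is_line (branch v H) (bt_adj v)"
  then obtain I f where f: "bij_betw f (I::int set) (branch v H)"
    "\<forall>i\<in>I. \<forall>j\<in>I. bt_adj v (f i) (f j) \<longleftrightarrow> \<bar>i - j\<bar> = 1"
    unfolding is_line_def by (elim exE conjE) (rule that)
  \<comment> \<open>The centre of a second child: p^m lies in \<open>B m\<close> but not in
    \<open>B (m + 1)\<close>.\<close>
  let ?b = "a + p powi m"
  have V: "ball_order a m \<in> branch v H" "ball_order a (m - 1) \<in> branch v H"
      "ball_order a (m + 1) \<in> branch v H" "ball_order ?b (m + 1) \<in> branch v H"
    using assms ball_suborder_subset[of a m] ball_suborder_subset_parent[of a m]
      ball_suborder_subset_child[of a a m] ball_suborder_subset_child[of a ?b m]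
    by (auto simp: branch_def maximal_order_iff)
  have ex: "\<exists>i\<in>I. f i = D" if "D \<in> branch v H" for D
  proof -
    have "D \<in> f ` I" using that bij_betw_imp_surj_on[OF f(1)] by simp
    then show ?thesis by auto
  qed
  obtain i where i: "i \<in> I" "f i = ball_order a m" using ex[OF V(1)] ..
  obtain i1 where i1: "i1 \<in> I" "f i1 = ball_order a (m - 1)" using ex[OF V(2)] ..
  obtain i2 where i2: "i2 \<in> I" "f i2 = ball_order a (m + 1)" using ex[OF V(3)] ..
  obtain i3 where i3: "i3 \<in> I" "f i3 = ball_order ?b (m + 1)" using ex[OF V(4)] ..
  have "\<bar>i - i1\<bar> = 1" "\<bar>i - i2\<bar> = 1" "\<bar>i - i3\<bar> = 1"
    using i i1 i2 i3 f(2)[rule_format, of i i1] f(2)[rule_format, of i i2] f(2)[rule_format, of i i3] by (auto simp: bt_adj_ball_order_iff)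
  moreover have "i1 \<noteq> i2" "i1 \<noteq> i3" "i2 \<noteq> i3"
    using i1 i2 i3 ball_order_eq_iff[of a "m - 1" a "m + 1"] ball_order_eq_iff[of a "m - 1" ?b "m + 1"]
      ball_order_eq_iff[of a "m + 1" ?b "m + 1"] by auto
  ultimately show False by linarith
qed

text \<open>The branch is convex and none of its vertices has three neighbours in it. It therefore
  consists of its largest ball and at most two descending arms, which are constructed
  explicitly.\<close>

lemma is_line_branch:
  assumes H: "full_order v H" and no_sub: "\<And>a m. \<not> H \<subseteq> ball_suborder a m"
  shows "is_line (branch v H) (bt_adj v)"
proof -
  define S where "S a m \<longleftrightarrow> H \<subseteq> ball_order a m" for a m
  have branch_eq: "branch v H = {ball_order a m |a m. S a m}"
    by (auto simp: branch_def maximal_order_iff S_def)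
  have between: "S a j" if "S a m" "S b l" "j \<le> m" "l \<le> j \<or> a - b \<notin> B (j + 1)" for a b m l j
    using that ball_order_between unfolding S_def by blast
  have no_parent_children: False
    if "S a (k + 1)" "S a (k - 1)" "S b (k + 1)" "a - b \<in> B k" "a - b \<notin> B (k + 1)" for a b k
    using that mem_ball_suborder_parent_children no_sub unfolding S_def by blast
  have no_three_children: False
    if "S a (k + 1)" "S b (k + 1)" "S c (k + 1)" "a - b \<in> B k" "a - b \<notin> B (k + 1)"
      "a - c \<in> B k" "a - c \<notin> B (k + 1)" "b - c \<notin> B (k + 1)" for a b c k
    using that mem_ball_suborder_three_children no_sub[of a k] unfolding S_def by blast
  obtain c1 where c1: "c1 \<noteq> 0" "msc c1 (M2 0 1 0 0) \<in> H" using H by (rule full_order_scale)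
  obtain c2 where c2: "c2 \<noteq> 0" "msc c2 (M2 0 0 1 0) \<in> H" using H by (rule full_order_scale)
  \<comment> \<open>Scaled matrix units in \<open>H\<close> bound the index of every ball in the
    branch, so that extreme balls exist.\<close>
  have upper: "m \<le> v c1" and lower: "- v c2 \<le> m" if "S a m" for a m
    using c1 c2 that unfolding S_def by (fastforce simp: ball_order_def B_iff)+
  have "\<exists>a m. S a m"
    using H order_subset_ball_order[of H] unfolding S_def full_order_def by metis
  then obtain aa mm where "S aa mm" by blast
  \<comment> \<open>The least index belongs to the largest ball. By \<open>close\<close> it contains
    all balls of the branch, and by \<open>chain\<close> the balls in between belong to the
    branch.\<close>
  obtain a0 m0 where top: "S a0 m0" and top_le: "\<And>b l. S b l \<Longrightarrow> m0 \<le> l"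
  proof -
    obtain t where t: "S (fst t) (snd t)"
      "\<And>s. S (fst s) (snd s) \<Longrightarrow> nat (snd t + v c2) \<le> nat (snd s + v c2)"
      using ex_has_least_nat[of "\<lambda>s. S (fst s) (snd s)" "(aa, mm)" "\<lambda>s. nat (snd s + v c2)"] \<open>S aa mm\<close>
      by auto
    have "snd t \<le> l" if "S b l" for b l
      using t(2)[of "(b, l)"] lower[OF that] lower[OF t(1)] that by simp
    with t(1) show thesis by (rule that)
  qed
  have close: "b - c \<in> B m0" if "S b l" "S c i" for b c l i
  proof (rule ccontr)
    assume "b - c \<notin> B m0"
    then have "S b (m0 - 1)" using top_le[OF that(1)] by (intro between[OF that]) auto
    with top_le[of b "m0 - 1"] show False by simp
  qed
  have chain: "S b j" if "S b l" "m0 \<le> j" "j \<le> l" for b j l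
    using between[OF that(1) top that(3)] that(2) by blast
  \<comment> \<open>If b - c had valuation k > m0, the ball of index \<open>k\<close> would have its
    parent and two children in the branch. Hence paths separate only at the top.\<close>
  have split_at_top: "b - c \<notin> B (m0 + 1)" if "S b l" "S c i" "i \<le> l" "b - c \<notin> B i" for b c l i
  proof
    assume bc: "b - c \<in> B (m0 + 1)"
    define k where "k = v (b - c)"
    have "b - c \<noteq> 0" using that(4) by auto
    then have k: "m0 + 1 \<le> k" "k < i" "b - c \<in> B k" "b - c \<notin> B (k + 1)"
      using that(4) bc by (auto simp: k_def B_iff)
    show False
      using k that(3) by (intro no_parent_children[of b k c] chain[OF that(1)] chain[OF that(2)]) auto
  qed
  have deepest: "\<exists>c i. P c i \<and> (\<forall>b l. P b l \<longrightarrow> l \<le> i)" if "\<exists>c i. P c i" "\<And>c i. P c i \<Longrightarrow> S c i" for P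
  proof -
    from that(1) obtain c i where "P c i" by blast
    then obtain t where t: "P (fst t) (snd t)"
      "\<And>s. P (fst s) (snd s) \<Longrightarrow> nat (v c1 - snd t) \<le> nat (v c1 - snd s)"
      using ex_has_least_nat[of "\<lambda>s. P (fst s) (snd s)" "(c, i)" "\<lambda>s. nat (v c1 - snd s)"]
      by auto
    have "l \<le> snd t" if "P b l" for b l
      using t(2)[of "(b, l)"] upper[of b l] upper[of "fst t" "snd t"] that t(1) \<open>\<And>c i. P c i \<Longrightarrow> S c i\<close> by simp
    with t(1) show ?thesis by blast
  qed
  obtain a M where aM: "S a M" and M_max: "\<And>b l. S b l \<Longrightarrow> l \<le> M"
    using deepest[of S] top by blast
  \<comment> \<open>The second arm ends at a deepest ball not containing \<open>a\<close>; a ball on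
    neither arm would give the top three children. If every ball contains \<open>a\<close>, the
    choice b = a, L = m0 leaves the second arm empty.\<close>
  obtain b L where bL: "S b L" and ab: "m0 < L \<Longrightarrow> a - b \<notin> B (m0 + 1)"
    and cover: "\<And>c i. S c i \<Longrightarrow> a - c \<in> B i \<or> (i \<le> L \<and> b - c \<in> B i)"
  proof (cases "\<exists>c i. S c i \<and> a - c \<notin> B i")
    case False
    show thesis
      by (rule that[of a m0]) (use False chain[OF aM] top_le[OF aM] in auto)
  next
    case True
    then obtain b L where bL: "S b L" "a - b \<notin> B L" and
      L_max: "\<And>c i. S c i \<Longrightarrow> a - c \<notin> B i \<Longrightarrow> i \<le> L"
      using deepest[of "\<lambda>c i. S c i \<and> a - c \<notin> B i"] by blast
    have ab: "a - b \<notin> B (m0 + 1)" using split_at_top[OF aM bL(1) M_max[OF bL(1)] bL(2)] .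
    show thesis
    proof (rule that[of b L])
      fix c i assume c: "S c i"
      show "a - c \<in> B i \<or> (i \<le> L \<and> b - c \<in> B i)"
      proof (rule ccontr)
        assume "\<not> (a - c \<in> B i \<or> (i \<le> L \<and> b - c \<in> B i))"
        then have ac: "a - c \<notin> B i" and "i \<le> L" "b - c \<notin> B i" using L_max[OF c] by auto
        then have bc: "b - c \<notin> B (m0 + 1)" using split_at_top[OF bL(1) c] by blast
        have ac': "a - c \<notin> B (m0 + 1)" using split_at_top[OF aM c M_max[OF c] ac] .
        have "i \<noteq> m0" using close[OF aM c] ac by auto
        then have "m0 + 1 \<le> i" using top_le[OF c] by simp
        then show False
          using \<open>i \<le> L\<close> M_max[OF bL(1)]
          by (intro no_three_children[of a m0 b c] chain[OF aM] chain[OF bL(1)] chain[OF c]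
              close[OF aM bL(1)] close[OF aM c] ab bc ac') auto
      qed
    qed (use bL ab in auto)
  qed
  have m0: "m0 \<le> M" "m0 \<le> L" using top_le aM bL by auto
  \<comment> \<open>\<open>f 0\<close> is the top; positive integers descend towards
    \<open>a\<close>, negative ones towards \<open>b\<close>.\<close>
  define f where "f j = (if j \<ge> 0 then ball_order a (m0 + j) else ball_order b (m0 - j))" for j
  define I where "I = {- (L - m0)..M - m0}"
  have ab_iff: "a - b \<in> B (m0 + i) \<longleftrightarrow> i \<le> 0" if "i \<le> L - m0" for i
    using B_mono[OF close[OF aM bL], of "m0 + i"] B_mono[of "a - b" "m0 + i" "m0 + 1"] ab that
    by (cases "i \<le> 0") auto
  have "inj_on f I"
  proof (rule inj_onI)
    fix i j assume "i \<in> I" "j \<in> I" "f i = f j"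
    then show "i = j"
      using ab_iff[of i] ab_iff[of j] B_minus_commute[of a b "m0 + j"]
      by (auto simp: f_def I_def ball_order_eq_iff split: if_splits)
  qed
  moreover have "f ` I = branch v H"
  proof (intro equalityI subsetI)
    fix D assume "D \<in> f ` I"
    then obtain j where "j \<in> I" "D = f j" by auto
    then show "D \<in> branch v H"
      using chain[OF aM, of "m0 + j"] chain[OF bL, of "m0 - j"]
      by (cases "j \<ge> 0") (auto simp: branch_eq f_def I_def)
  next
    fix D assume "D \<in> branch v H"
    then obtain c i where D: "D = ball_order c i" and c: "S c i" by (auto simp: branch_eq)
    from cover[OF c] show "D \<in> f ` I"
    proof
      assume "a - c \<in> B i"
      then have "D = f (i - m0)"
        using top_le[OF c] B_minus_commute[of a c] by (simp add: f_def D ball_order_eq_iff)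
      then show ?thesis using top_le[OF c] M_max[OF c] m0 by (auto simp: I_def)
    next
      assume *: "i \<le> L \<and> b - c \<in> B i"
      have "D = f (m0 - i)"
      proof (cases "i = m0")
        case True
        then show ?thesis using close[OF c aM] by (simp add: f_def D ball_order_eq_iff)
      next
        case False
        then show ?thesis
          using * top_le[OF c] B_minus_commute[of b c] by (simp add: f_def D ball_order_eq_iff)
      qed
      then show ?thesis using * top_le[OF c] m0 by (auto simp: I_def)
    qed
  qed
  moreover have "bt_adj v (f i) (f j) \<longleftrightarrow> \<bar>i - j\<bar> = 1" if "i \<in> I" "j \<in> I" for i j
  proof -
    \<comment> \<open>Across the arms, a vertex with index at least 0 is adjacent to one with
      negative index only when the former is the top and the latter is its child towards
      \<open>b\<close>.\<close>
    have mixed: "\<bar>m0 + i - (m0 - j)\<bar> = 1 \<and> a - b \<in> B (min (m0 + i) (m0 - j)) \<longleftrightarrow> \<bar>i - j\<bar> = 1"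
      if "0 \<le> i" "j < 0" "i \<in> I" "j \<in> I" for i j
    proof -
      have "min (m0 + i) (m0 - j) = m0 + min i (- j)" by simp
      moreover have "min i (- j) \<le> L - m0" using that by (auto simp: I_def)
      ultimately have "a - b \<in> B (min (m0 + i) (m0 - j)) \<longleftrightarrow> i = 0"
        using ab_iff[of "min i (- j)"] that by auto
      then show ?thesis using that by auto
    qed
    show ?thesis
      using that mixed[of i j] mixed[of j i]
        B_minus_commute[of b a]
      by (auto simp: f_def bt_adj_ball_order_iff abs_minus_commute min.commute)
  qed
  ultimately show ?thesis
    unfolding is_line_def bij_betw_def using m0
    by (intro exI[of _ I] exI[of _ f]) (auto simp: I_def)
qed

end

section \<open>The Gorenstein property\<close>

context valued_field
begin

text \<open>A linear system of determinant 1, which avoids a division by 2.\<close>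

lemma B_div2: "2 * x + y \<in> B 0 \<Longrightarrow> x + y \<in> B 0 \<Longrightarrow> x \<in> B 0 \<and> y \<in> B 0"
  using B_diff[of "2 * x + y" 0 "x + y"] B_diff[of "x + y" 0 x] by simp

section \<open>The codifferent and its generators\<close>

lemma OK_module_codifferent: "OK_module (codifferent v R)"
proof (rule OK_moduleI)
  show "0 \<in> codifferent v R" by (simp add: codifferent_def zero_M2 mat2_eq_iff trace_def sum_2 matrix_matrix_mult_def)
qed (simp_all add: codifferent_def matrix_mult_distrib trace_add B_add msc_mult_left trace_msc B_mult0)

lemma codifferent_mult:
  assumes "is_order v R" "X \<in> codifferent v R" "Y \<in> R"
  shows "X ** Y \<in> codifferent v R" "Y ** X \<in> codifferent v R"
proof -
  show "X ** Y \<in> codifferent v R"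
    using assms order_mult[OF assms(1)] by (simp add: codifferent_def flip: matrix_mul_assoc)
  have "trace (Y ** X ** Z) \<in> B 0" if "Z \<in> R" for Z
  proof -
    have "trace (Y ** X ** Z) = trace (X ** (Z ** Y))"
      using trace_mul_sym[of Y "X ** Z"] by (simp add: matrix_mul_assoc)
    then show ?thesis using assms(2) order_mult[OF assms(1) that assms(3)] by (simp add: codifferent_def)
  qed
  then show "Y ** X \<in> codifferent v R" by (simp add: codifferent_def)
qed

lemma mat_mem_order: "is_order v R \<Longrightarrow> c \<in> B 0 \<Longrightarrow> mat c \<in> R"
  by (subst mat_eq_msc) (blast intro: OK_module_msc order_module order_1)

lemma fg_spans_mult_left:
  assumes M: "OK_module M" "bounded_set M" "spans_A M" and gh: "g ** h = mat 1"
  shows "fg_OK_module v ((\<lambda>X. g ** X) ` M) \<and> spans_A ((\<lambda>X. g ** X) ` M)"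
proof -
  have mod: "OK_module ((\<lambda>X. g ** X) ` M)"
  proof (rule OK_moduleI)
    have "g ** 0 = 0" by (cases g rule: M2_cases) (simp add: zero_M2)
    then show "0 \<in> (\<lambda>X. g ** X) ` M" using OK_module_0[OF M(1)] by force
  next
    fix x y assume "x \<in> (\<lambda>X. g ** X) ` M" "y \<in> (\<lambda>X. g ** X) ` M"
    then show "x + y \<in> (\<lambda>X. g ** X) ` M"
      using OK_module_add[OF M(1)] by (auto simp flip: matrix_mult_add_right)
  next
    fix c x assume "c \<in> B 0" "x \<in> (\<lambda>X. g ** X) ` M"
    then show "msc c x \<in> (\<lambda>X. g ** X) ` M"
      using OK_module_msc[OF M(1)] by (auto simp flip: msc_mult_right)
  qed
  have "bounded_set ((\<lambda>X. g ** X) ` M)"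
  proof -
    have "finite (range (\<lambda>(i, j). g$i$j))" by simp
    from B_exists_common[OF this] obtain n where n: "g$i$j \<in> B n" for i j by fastforce
    obtain k where k: "\<And>x i j. x \<in> M \<Longrightarrow> x$i$j \<in> B k" using M(2) by (auto simp: bounded_set_def)
    have "\<forall>x\<in>(\<lambda>X. g ** X) ` M. \<forall>i j. x$i$j \<in> B (n + k)"
      using n k by (auto simp: matrix_matrix_mult_def sum_2 intro!: B_add B_mult)
    then show ?thesis unfolding bounded_set_def by blast
  qed
  moreover have "spans_A ((\<lambda>X. g ** X) ` M)"
    unfolding spans_A_iff[OF mod]
  proof
    fix X
    obtain c where c: "c \<noteq> 0" "msc c (h ** X) \<in> M" using M(3) by (auto simp: spans_A_iff[OF M(1)])
    have "msc c X = g ** msc c (h ** X)" by (simp add: msc_mult_right matrix_mul_assoc gh)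
    then show "\<exists>c. c \<noteq> 0 \<and> msc c X \<in> (\<lambda>X. g ** X) ` M" using c by blast
  qed
  ultimately show ?thesis using mod by (simp add: fg_OK_module_iff)
qed

text \<open>The hypotheses make \<open>e\<close> a generator of the codifferent on both sides, C =
  eR = Re, and the inverse ideal is hR = Rh.\<close>

lemma gorenstein_of_generator:
  assumes R: "full_order v R" and eh: "e ** h = mat 1" "h ** e = mat 1"
    and e: "e \<in> codifferent v R"
    and h: "\<And>X. X \<in> codifferent v R \<Longrightarrow> h ** X \<in> R \<and> X ** h \<in> R"
  shows "gorenstein v R"
proof -
  let ?C = "codifferent v R"
  let ?J = "(\<lambda>X. h ** X) ` R"
  have O: "is_order v R" "spans_A R" using R by (auto simp: full_order_def)
  note cm = codifferent_mult[OF O(1)] and om = order_mult[OF O(1)]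
  have cancel: "e ** (h ** X) = X" "h ** (e ** X) = X" "X ** e ** h = X" "X ** h ** e = X" for X
    by (simp_all add: eh matrix_mul_assoc) (simp_all add: eh flip: matrix_mul_assoc)
  have C: "?C = (\<lambda>X. e ** X) ` R" "?C = (\<lambda>X. X ** e) ` R"
  proof -
    have "X \<in> (\<lambda>X. e ** X) ` R \<and> X \<in> (\<lambda>X. X ** e) ` R" if "X \<in> ?C" for X
      using h[OF that] cancel(1,4)[of X] by (metis imageI)
    then show "?C = (\<lambda>X. e ** X) ` R" "?C = (\<lambda>X. X ** e) ` R"
      using cm[OF e] by auto
  qed
  \<comment> \<open>Here and in \<open>J1\<close>, hR = Rh follows from e ** X ** h = e (X h) and
    its mirror image, as eR and Re are both the codifferent.\<close>
  have J2: "X ** h \<in> ?J" if "X \<in> R" for X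
  proof -
    have "X ** h = h ** (e ** X ** h)" by (simp add: matrix_mul_assoc eh)
    then show ?thesis using h[OF cm(1)[OF e that]] by blast
  qed
  have J1: "h ** X \<in> (\<lambda>X. X ** h) ` R" if "X \<in> R" for X
  proof -
    have "h ** X = (h ** (X ** e)) ** h" by (simp add: cancel matrix_mul_assoc)
    then show ?thesis using h[OF cm(2)[OF e that]] by blast
  qed
  have fracC: "frac_ideal v R ?C"
    unfolding frac_ideal_def
  proof (intro conjI ballI)
    show "fg_OK_module v ?C" "spans_A ?C"
      unfolding C(1) using fg_spans_mult_left[OF order_module[OF O(1)] order_bounded[OF O(1)] O(2) eh(1)] by auto
  qed (use cm in auto)
  have fracJ: "frac_ideal v R ?J"
    unfolding frac_ideal_def
  proof (intro conjI ballI)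
    show "fg_OK_module v ?J" "spans_A ?J"
      using fg_spans_mult_left[OF order_module[OF O(1)] order_bounded[OF O(1)] O(2) eh(2)] by auto
    fix r x assume r: "r \<in> R" and "x \<in> ?J"
    then obtain y where y: "y \<in> R" "x = h ** y" by auto
    from y r show "x ** r \<in> ?J" using om by (auto simp flip: matrix_mul_assoc)
    obtain z where z: "z \<in> R" "x = z ** h" using J1[OF y(1)] y(2) by auto
    from z r show "r ** x \<in> ?J" using J2[OF om[OF r z(1)]] by (simp add: matrix_mul_assoc)
  qed
  have sums: "(\<Sum>k\<in>F. f k) \<in> R" if "\<And>k. k \<in> F \<Longrightarrow> f k \<in> R" for f and F :: "nat set"
    using that by (rule OK_module_sum[OF order_module[OF O(1)]])
  have single: "X ** Y \<in> set_mult I K" if "X \<in> I" "Y \<in> K" for X Y and I K :: "'a mat2 set"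
    unfolding set_mult_def using that
    by (intro CollectI exI[of _ "{0}"] exI[of _ "\<lambda>_. X"] exI[of _ "\<lambda>_. Y"]) auto
  have "X ** Y \<in> R" if "X \<in> ?C" "Y \<in> ?J" for X Y
  proof -
    obtain r s where "X = r ** e" "r \<in> R" "Y = h ** s" "s \<in> R" using \<open>X \<in> ?C\<close> \<open>Y \<in> ?J\<close> C(2) by auto
    moreover have "r ** e ** (h ** s) = r ** s" by (simp add: matrix_mul_assoc cancel)
    ultimately show ?thesis using om by simp
  qed
  then have "set_mult ?C ?J \<subseteq> R" by (auto simp: set_mult_def intro!: sums)
  moreover have "R \<subseteq> set_mult ?C ?J"
  proof
    fix X assume "X \<in> R"
    then have "e ** (h ** X) \<in> set_mult ?C ?J" using e by (intro single) auto
    then show "X \<in> set_mult ?C ?J" by (simp add: cancel)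
  qed
  moreover have "Y ** X \<in> R" if "X \<in> ?C" "Y \<in> ?J" for X Y
  proof -
    obtain s where "Y = h ** s" "s \<in> R" using \<open>Y \<in> ?J\<close> by auto
    moreover obtain r where "Y = r ** h" "r \<in> R" using calculation J1 by blast
    moreover obtain t where "X = e ** t" "t \<in> R" using \<open>X \<in> ?C\<close> C(1) by auto
    moreover have "r ** h ** (e ** t) = r ** t" by (simp add: matrix_mul_assoc cancel)
    ultimately show ?thesis using om by simp
  qed
  then have "set_mult ?J ?C \<subseteq> R" by (auto simp: set_mult_def intro!: sums)
  moreover have "R \<subseteq> set_mult ?J ?C"
  proof
    fix X assume X: "X \<in> R"
    have "h \<in> ?J" using J2[OF order_1[OF O(1)]] by simp
    then have "h ** (e ** X) \<in> set_mult ?J ?C" using cm(1)[OF e X] by (intro single)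
    then show "X \<in> set_mult ?J ?C" by (simp add: cancel)
  qed
  ultimately have "set_mult ?C ?J = R" "set_mult ?J ?C = R" by auto
  then show ?thesis using R fracC fracJ by (auto simp: gorenstein_def invertible_ideal_def)
qed

end

section \<open>Orders with a dual basis\<close>

text \<open>The traceless matrices \<open>f1, f2, f3\<close> are dual to the basis \<open>1, e1, e2, e3\<close> of the order, which is
  recovered from them, up to scalars, by their pairwise products.\<close>

locale order_basis = valued_field +
  fixes R e1 e2 e3 f1 f2 f3 t s1 s2 s3
  assumes R: "is_order v R"
    and e: "e1 \<in> R" "e2 \<in> R" "e3 \<in> R"
    and expand: "X \<in> R \<Longrightarrow>
       \<exists>c0\<in>B 0. \<exists>c1\<in>B 0. \<exists>c2\<in>B 0. \<exists>c3\<in>B 0. X = mat c0 + msc c1 e1 + msc c2 e2 + msc c3 e3"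
    and expand_traceless: "trace Y = 0 \<Longrightarrow>
       Y = msc (trace (Y ** e1)) f1 + msc (trace (Y ** e2)) f2 + msc (trace (Y ** e3)) f3"
    and trace_f: "trace f1 = 0" "trace f2 = 0" "trace f3 = 0"
    and dual1: "trace (f1 ** e1) = 1" "trace (f1 ** e2) = 0" "trace (f1 ** e3) = 0"
    and dual2: "trace (f2 ** e1) = 0" "trace (f2 ** e2) = 1" "trace (f2 ** e3) = 0"
    and dual3: "trace (f3 ** e1) = 0" "trace (f3 ** e2) = 0" "trace (f3 ** e3) = 1"
    and t_nz: "t \<noteq> 0"
    and prods: "f2 ** f3 = msc t (e1 - mat s1)" "f3 ** f1 = msc t (e2 - mat s2)"
      "f1 ** f2 = msc t (e3 - mat s3)"
begin

text \<open>The axioms are invariant under cyclic permutation of the indices, so a fact about one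
  index transfers to all three.\<close>

lemma rotated: "order_basis v p R e2 e3 e1 f2 f3 f1 t s2 s3 s1"
proof
  show "\<exists>c0\<in>B 0. \<exists>c1\<in>B 0. \<exists>c2\<in>B 0. \<exists>c3\<in>B 0. X = mat c0 + msc c1 e2 + msc c2 e3 + msc c3 e1"
    if X: "X \<in> R" for X
  proof -
    obtain c0 c1 c2 c3 where c: "c0 \<in> B 0" "c1 \<in> B 0" "c2 \<in> B 0" "c3 \<in> B 0"
      "X = mat c0 + msc c1 e1 + msc c2 e2 + msc c3 e3" using expand[OF X] by blast
    have "X = mat c0 + msc c2 e2 + msc c3 e3 + msc c1 e1" unfolding c(5) by (simp add: add_ac)
    with c(1-4) show ?thesis by blast
  qed
  show "Y = msc (trace (Y ** e2)) f2 + msc (trace (Y ** e3)) f3 + msc (trace (Y ** e1)) f1"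
    if "trace Y = 0" for Y
    using expand_traceless[OF that] by (simp add: add_ac)
qed (fact R e trace_f dual1 dual2 dual3 t_nz prods)+

lemma f1_codifferent: "f1 \<in> codifferent v R"
proof -
  have "trace (f1 ** X) \<in> B 0" if X: "X \<in> R" for X
  proof -
    obtain c0 c1 c2 c3 where c: "c1 \<in> B 0"
      "X = mat c0 + msc c1 e1 + msc c2 e2 + msc c3 e3" using expand[OF X] by blast
    have "trace (f1 ** X) = c1"
      unfolding c(2) by (simp add: matrix_mult_distrib trace_add msc_mult_right trace_msc trace_mult_mat trace_f dual1)
    with c(1) show ?thesis by simp
  qed
  then show ?thesis by (simp add: codifferent_def)
qed

lemma e1_eq: "e1 = msc (1 / t) (f2 ** f3) + mat s1"
  using t_nz by (simp add: prods msc_msc msc_1)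

text \<open>The product \<open>f3 ** e1\<close> is in the codifferent and is a combination of
  \<open>f2\<close> and \<open>f3\<close>; pairing it with \<open>e2\<close> and \<open>e3\<close>
  reads off integral coefficients. The trace of \<open>e1\<close> supplies the second equation
  needed to separate \<open>s1\<close> from the trace term.\<close>

lemma integral1:
  assumes "f3 \<in> codifferent v R"
  shows "det f3 / t \<in> B 0" "trace (f2 ** f3) / t \<in> B 0" "s1 \<in> B 0"
proof -
  let ?b = "trace (f2 ** f3)"
  have eq: "f3 ** e1 = msc (?b / t + s1) f3 + msc (det f3 / t) f2"
  proof -
    have "f3 ** e1 = msc (1 / t) (f3 ** (f2 ** f3)) + msc s1 f3"
      by (subst e1_eq) (simp add: matrix_mult_distrib msc_mult_right mat_mult_right)
    also have "f3 ** (f2 ** f3) = msc ?b f3 + msc (det f3) f2"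
      using traceless_sandwich[OF trace_f(3,2)] trace_mul_sym[of f3 f2] by simp
    finally show ?thesis by (simp add: msc_add msc_msc msc_add_left add_ac)
  qed
  have "f3 ** e1 \<in> codifferent v R" by (rule codifferent_mult[OF R assms e(1)])
  then have "trace (f3 ** e1 ** e2) \<in> B 0" "trace (f3 ** e1 ** e3) \<in> B 0"
    using e by (simp_all add: codifferent_def)
  then have 1: "det f3 / t \<in> B 0" "?b / t + s1 \<in> B 0"
    unfolding eq by (simp_all add: matrix_mult_distrib trace_add msc_mult_left trace_msc dual2 dual3)
  have "trace e1 \<in> B 0" using R e(1) by (rule order_trace)
  then have "2 * s1 + ?b / t \<in> B 0"
    by (subst (asm) e1_eq) (simp add: trace_add trace_msc trace_mat add_ac)
  with 1 show "det f3 / t \<in> B 0" "?b / t \<in> B 0" "s1 \<in> B 0"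
    using B_div2[of s1 "?b / t"] by (auto simp: add.commute)
qed

end

context order_basis
begin

interpretation rot: order_basis v p R e2 e3 e1 f2 f3 f1 t s2 s3 s1 by (rule rotated)
interpretation rot2: order_basis v p R e3 e1 e2 f3 f1 f2 t s3 s1 s2 by (rule rot.rotated)

lemma f_codifferent: "f1 \<in> codifferent v R" "f2 \<in> codifferent v R" "f3 \<in> codifferent v R"
  by (fact f1_codifferent rot.f1_codifferent rot2.f1_codifferent)+

lemma s_integral: "s1 \<in> B 0" "s2 \<in> B 0" "s3 \<in> B 0"
  and det_integral: "det f1 / t \<in> B 0" "det f2 / t \<in> B 0" "det f3 / t \<in> B 0"
  and trace_integral: "trace (f2 ** f3) / t \<in> B 0" "trace (f3 ** f1) / t \<in> B 0" "trace (f1 ** f2) / t \<in> B 0"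
  using integral1[OF f_codifferent(3)] rot.integral1[OF f_codifferent(1)] rot2.integral1[OF f_codifferent(2)]
  by auto

text \<open>The lattice t R, which contains all products of two of the \<open>f1\<close>,
  \<open>f2\<close>, \<open>f3\<close> (\<open>prods_tR\<close>).\<close>

definition tR :: "'a mat2 set" where "tR = {X. msc (1 / t) X \<in> R}"

lemma OK_module_tR: "OK_module tR"
proof (rule OK_moduleI)
  fix c x assume c: "c \<in> B 0" and "x \<in> tR"
  then have "msc c (msc (1 / t) x) \<in> R" by (simp add: tR_def OK_module_msc[OF order_module[OF R]])
  then show "msc c x \<in> tR" by (simp add: tR_def msc_msc mult.commute)
qed (use order_module[OF R] in \<open>simp_all add: tR_def OK_module_def msc_zero msc_add\<close>)

lemma tR_mult:
  assumes "X \<in> tR" "Y \<in> R"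
  shows "X ** Y \<in> tR" "Y ** X \<in> tR"
  using assms order_mult[OF R, of "msc (1 / t) X" Y] order_mult[OF R, of Y "msc (1 / t) X"]
  by (simp_all add: tR_def msc_mult_left msc_mult_right)

lemma prod_tR: "f1 ** f1 \<in> tR" "f2 ** f3 \<in> tR" "f3 ** f2 \<in> tR"
proof -
  have m: "mat c \<in> R" if "c \<in> B 0" for c using mat_mem_order[OF R that] .
  have "- (det f1 / t) \<in> B 0" using det_integral by simp
  then show "f1 ** f1 \<in> tR" by (simp add: tR_def traceless_square trace_f msc_mat m)
  show 23: "f2 ** f3 \<in> tR"
    using e(1) m[OF s_integral(1)] OK_module_diff[OF order_module[OF R]]
    by (simp add: tR_def prods msc_msc t_nz msc_1)
  have "mat (trace (f2 ** f3)) \<in> tR" using trace_integral(1) by (simp add: tR_def msc_mat m)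
  then show "f3 ** f2 \<in> tR"
    using 23 traceless_anticommute[OF trace_f(2,3)] OK_module_diff[OF OK_module_tR] by simp
qed

end

context order_basis
begin

interpretation rot: order_basis v p R e2 e3 e1 f2 f3 f1 t s2 s3 s1 by (rule rotated)
interpretation rot2: order_basis v p R e3 e1 e2 f3 f1 f2 t s3 s1 s2 by (rule rot.rotated)

lemma prods_tR:
  assumes "x \<in> {f1, f2, f3}" "y \<in> {f1, f2, f3}"
  shows "x ** y \<in> tR"
proof -
  have "rot.tR = tR" "rot2.tR = tR" by (simp_all add: tR_def rot.tR_def rot2.tR_def)
  then show ?thesis using assms prod_tR rot.prod_tR rot2.prod_tR by auto
qed

text \<open>The vector f1 (e1 - s1) lies in the codifferent and has trace 1. Subtracting a multiple
  of it makes an element traceless, and the rest expands in the dual vectors with integral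
  coefficients.\<close>

lemma codifferent_expand:
  assumes x: "x \<in> codifferent v R"
  obtains c0 c1 c2 c3 where "c0 \<in> B 0" "c1 \<in> B 0" "c2 \<in> B 0" "c3 \<in> B 0"
    "x = msc c0 (f1 ** (e1 - mat s1)) + msc c1 f1 + msc c2 f2 + msc c3 f3"
proof -
  define w where "w = f1 ** (e1 - mat s1)"
  have "e1 - mat s1 \<in> R"
    using e(1) s_integral(1) mat_mem_order[OF R] OK_module_diff[OF order_module[OF R]] by blast
  then have w: "w \<in> codifferent v R" using codifferent_mult[OF R f_codifferent(1)] by (simp add: w_def)
  have tr_w: "trace w = 1"
    by (simp add: w_def matrix_mult_distrib trace_sub dual1 trace_mult_mat trace_f)
  define c where "c = trace x"
  have "trace (x ** mat 1) \<in> B 0" using x order_1[OF R] unfolding codifferent_def by blast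
  then have c: "c \<in> B 0" by (simp add: c_def)
  define y where "y = x - msc c w"
  have y: "y \<in> codifferent v R"
    unfolding y_def using x w c OK_module_codifferent by (blast intro: OK_module_diff OK_module_msc)
  have "trace y = 0" by (simp add: y_def trace_sub trace_msc tr_w c_def)
  from expand_traceless[OF this]
  have "x = msc c w + msc (trace (y ** e1)) f1 + msc (trace (y ** e2)) f2 + msc (trace (y ** e3)) f3"
    by (simp add: y_def algebra_simps)
  moreover have "trace (y ** e1) \<in> B 0" "trace (y ** e2) \<in> B 0" "trace (y ** e3) \<in> B 0"
    using y e by (auto simp: codifferent_def)
  ultimately show thesis using c by (intro that) (simp_all add: w_def)
qed

lemma mult_codifferent_tR:
  assumes y: "\<And>f. f \<in> {f1, f2, f3} \<Longrightarrow> y ** f \<in> tR \<and> f ** y \<in> tR" and x: "x \<in> codifferent v R"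
  shows "y ** x \<in> tR" "x ** y \<in> tR"
proof -
  obtain c0 c1 c2 c3 where c: "c0 \<in> B 0" "c1 \<in> B 0" "c2 \<in> B 0" "c3 \<in> B 0"
    and x: "x = msc c0 (f1 ** (e1 - mat s1)) + msc c1 f1 + msc c2 f2 + msc c3 f3"
    using x by (rule codifferent_expand)
  have es: "e1 - mat s1 \<in> R" "e3 - mat s3 \<in> R"
    using e s_integral mat_mem_order[OF R] OK_module_diff[OF order_module[OF R]] by blast+
  \<comment> \<open>The trace 1 vector is f1 f2 f3 / t, so it has \<open>f1\<close> as left factor
    and \<open>f3\<close> as right factor, and can be multiplied by \<open>y\<close> from either
    side.\<close>
  have "f1 ** (e1 - mat s1) = msc (1 / t) (f1 ** (f2 ** f3))"
    using t_nz by (simp add: prods msc_msc msc_1 msc_mult_right)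
  also have "\<dots> = (e3 - mat s3) ** f3"
    unfolding matrix_mul_assoc prods(3) using t_nz by (simp add: msc_msc msc_1 msc_mult_left)
  finally have w: "f1 ** (e1 - mat s1) = (e3 - mat s3) ** f3" .
  have "y ** (f1 ** (e1 - mat s1)) \<in> tR"
    using tR_mult(1)[OF _ es(1), of "y ** f1"] y by (simp add: matrix_mul_assoc)
  moreover have "f1 ** (e1 - mat s1) ** y \<in> tR"
    unfolding w using tR_mult(2)[OF _ es(2), of "f3 ** y"] y by (simp add: matrix_mul_assoc)
  ultimately show "y ** x \<in> tR" "x ** y \<in> tR"
    using y c OK_module_tR unfolding x
    by (simp_all add: matrix_mult_distrib msc_mult_left msc_mult_right OK_module_add OK_module_msc)
qed

text \<open>The inverse of \<open>y\<close> is - y / det y. Multiplying the codifferent by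
  \<open>y\<close> lands in t R, and t / det y is integral, so \<open>y\<close> is a two-sided
  generator.\<close>

lemma gorenstein_of_det:
  assumes full: "full_order v R" and "trace y = 0"
    and y: "\<And>f. f \<in> {f1, f2, f3} \<Longrightarrow> y ** f \<in> tR \<and> f ** y \<in> tR" "y \<in> codifferent v R"
    and det: "det y \<noteq> 0" "v (det y) \<le> v t"
  shows "gorenstein v R"
proof (rule gorenstein_of_generator[OF full])
  let ?h = "msc (- 1 / det y) y"
  show "y ** ?h = mat 1" "?h ** y = mat 1"
    using det by (simp_all add: msc_mult_left msc_mult_right traceless_square[OF assms(2)] msc_mat)
  show "y \<in> codifferent v R" by fact
  have c: "- t / det y \<in> B 0" using det t_nz by (simp add: B_divide_iff) (simp add: B_iff)
  have "msc (- 1 / det y) X \<in> R" if "X \<in> tR" for X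
  proof -
    have "msc (- t / det y) (msc (1 / t) X) \<in> R"
      using that c order_module[OF R] by (simp add: tR_def OK_module_msc)
    then show ?thesis using t_nz by (simp add: msc_msc)
  qed
  then show "?h ** X \<in> R \<and> X ** ?h \<in> R" if "X \<in> codifferent v R" for X
    using mult_codifferent_tR[OF y(1) that] by (simp add: msc_mult_left msc_mult_right)
qed

end

section \<open>Orders from integral ternary forms\<close>

context valued_field
begin

text \<open>Squares are handled by Cayley-Hamilton. In the product of yz and zx the inner square of
  \<open>z\<close> is scalar, which leaves a multiple of yx; the opposite order follows by polarised
  Cayley-Hamilton.\<close>

lemma traceless_products:
  assumes tr: "trace x = 0" "trace y = 0" "trace z = 0" and u: "u \<noteq> 0"
    and det: "det x / u \<in> B 0" "det y / u \<in> B 0" "det z / u \<in> B 0"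
    and pair: "trace (y ** z) / u \<in> B 0" "trace (z ** x) / u \<in> B 0" "trace (x ** y) / u \<in> B 0"
    and M: "OK_module M" "\<And>c. c \<in> B 0 \<Longrightarrow> mat c \<in> M"
      "msc (1 / u) (y ** z) \<in> M" "msc (1 / u) (z ** x) \<in> M" "msc (1 / u) (x ** y) \<in> M"
  shows "msc (1 / u) (y ** z) ** msc (1 / u) (y ** z) \<in> M"
    "msc (1 / u) (y ** z) ** msc (1 / u) (z ** x) \<in> M"
    "msc (1 / u) (z ** x) ** msc (1 / u) (y ** z) \<in> M"
proof -
  define g1 where "g1 = msc (1 / u) (y ** z)"
  define g2 where "g2 = msc (1 / u) (z ** x)"
  define g3 where "g3 = msc (1 / u) (x ** y)"
  have g: "g1 \<in> M" "g2 \<in> M" "g3 \<in> M" using M by (simp_all add: g1_def g2_def g3_def)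
  have tr_g: "trace g1 \<in> B 0" "trace g2 \<in> B 0" "trace g3 \<in> B 0"
    using pair by (simp_all add: g1_def g2_def g3_def trace_msc)
  have "det g1 = (det y / u) * (det z / u)" by (simp add: g1_def det_msc det_mult)
  then have "det g1 \<in> B 0" using B_mult0[OF det(2,3)] by simp
  then have "g1 ** g1 \<in> M"
    unfolding mat2_square using M(1,2) g tr_g by (intro OK_module_diff[OF M(1)] OK_module_msc[OF M(1)]) auto
  moreover have g12: "g1 ** g2 = msc (- (det z / u)) (mat (trace g3) - g3)"
  proof -
    have "g1 ** g2 = msc (1 / u * (1 / u)) (y ** (z ** z) ** x)"
      by (simp add: g1_def g2_def msc_mult_left msc_mult_right msc_msc matrix_mul_assoc)
    also have "\<dots> = msc (1 / u * (1 / u) * (- det z)) (y ** x)"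
      by (simp add: traceless_square[OF tr(3)] mat_mult_right msc_mult_left msc_msc)
    also have "\<dots> = msc (- (det z / u)) (msc (1 / u) (mat (trace (x ** y)) - x ** y))"
      by (simp add: traceless_anticommute[OF tr(1,2)] msc_msc)
    also have "msc (1 / u) (mat (trace (x ** y)) - x ** y) = mat (trace g3) - g3"
      by (simp add: g3_def msc_diff msc_mat trace_msc)
    finally show ?thesis .
  qed
  have nz: "- (det z / u) \<in> B 0" using det(3) by simp
  then have g12M: "g1 ** g2 \<in> M"
    unfolding g12 using M(2) g tr_g by (intro OK_module_msc[OF M(1)] OK_module_diff[OF M(1)]) auto
  have "trace (g1 ** g2) \<in> B 0"
    unfolding g12 trace_msc trace_sub trace_mat using nz tr_g by (intro B_mult0) simp_all
  then have "g2 ** g1 \<in> M"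
    unfolding mat2_anticommute[of g2 g1] using M(2) g tr_g g12M
    by (intro OK_module_diff[OF M(1)] OK_module_add[OF M(1)] OK_module_msc[OF M(1)]) (auto intro: B_diff B_mult0)
  ultimately show "msc (1 / u) (y ** z) ** msc (1 / u) (y ** z) \<in> M"
    "msc (1 / u) (y ** z) ** msc (1 / u) (z ** x) \<in> M"
    "msc (1 / u) (z ** x) ** msc (1 / u) (y ** z) \<in> M"
    using g12M by (simp_all add: g1_def g2_def)
qed

text \<open>If the form - det / u is integral on the span of \<open>x\<close>, \<open>y\<close>,
  \<open>z\<close>, the image of its even Clifford algebra is an order, spanned by 1 and the three
  products divided by \<open>u\<close>.\<close>

lemma order_of_traceless:
  assumes tr: "trace x = 0" "trace y = 0" "trace z = 0" and u: "u \<noteq> 0"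
    and det: "det x / u \<in> B 0" "det y / u \<in> B 0" "det z / u \<in> B 0"
    and pair: "trace (y ** z) / u \<in> B 0" "trace (z ** x) / u \<in> B 0" "trace (x ** y) / u \<in> B 0"
  obtains M where "is_order v M"
    "msc (1 / u) (y ** z) \<in> M" "msc (1 / u) (z ** x) \<in> M" "msc (1 / u) (x ** y) \<in> M"
proof -
  define g1 where "g1 = msc (1 / u) (y ** z)"
  define g2 where "g2 = msc (1 / u) (z ** x)"
  define g3 where "g3 = msc (1 / u) (x ** y)"
  define M where "M = lin_combs (B 0) {mat 1, g1, g2, g3}"
  have "fg_OK_module v M" unfolding fg_OK_module_def
    by (intro exI[of _ "{mat 1, g1, g2, g3}"]) (simp add: M_def)
  then have M: "OK_module M" "bounded_set M" by (auto simp: fg_OK_module_iff)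
  have gen: "mat 1 \<in> M" and g: "g1 \<in> M" "g2 \<in> M" "g3 \<in> M"
    using lin_combs_superset[of "{mat 1, g1, g2, g3}"] by (auto simp: M_def)
  have mat: "mat c \<in> M" if "c \<in> B 0" for c
    by (subst mat_eq_msc) (rule OK_module_msc[OF M(1) that gen])
  note pr = traceless_products[OF _ _ _ u _ _ _ _ _ _ M(1) mat]
  have prods: "a ** b \<in> M" if "a \<in> {g1, g2, g3}" "b \<in> {g1, g2, g3}" for a b
    using that pr[of x y z] pr[of y z x] pr[of z x y] assms g unfolding g1_def g2_def g3_def by auto
  \<comment> \<open>Closure is extended from generators to the span one factor at a time.\<close>
  have left: "a ** b \<in> M" if "a \<in> {mat 1, g1, g2, g3}" "b \<in> M" for a b
  proof -
    have "M \<subseteq> {b. a ** b \<in> M}"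
      unfolding M_def
    proof (rule lin_combs_minimal, fold M_def)
      show "{mat 1, g1, g2, g3} \<subseteq> {b. a ** b \<in> M}" using that prods g gen by auto
      have "a ** 0 = 0" by (cases a rule: M2_cases) (simp add: zero_M2)
      then show "OK_module {b. a ** b \<in> M}"
        using OK_moduleD[OF M(1)] by (intro OK_moduleI) (simp_all add: matrix_mult_distrib msc_mult_right)
    qed
    with that show ?thesis by blast
  qed
  have "a ** b \<in> M" if "a \<in> M" "b \<in> M" for a b
  proof -
    have "M \<subseteq> {a. a ** b \<in> M}"
      unfolding M_def
    proof (rule lin_combs_minimal, fold M_def)
      show "{mat 1, g1, g2, g3} \<subseteq> {a. a ** b \<in> M}" using left that by auto
      have "0 ** b = 0" by (cases b rule: M2_cases) (simp add: zero_M2)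
      then show "OK_module {a. a ** b \<in> M}"
        using OK_moduleD[OF M(1)] by (intro OK_moduleI) (simp_all add: matrix_mult_distrib msc_mult_left)
    qed
    with that show ?thesis by blast
  qed
  then have "is_order v M" using gen M by (auto simp: is_order_iff)
  then show thesis using g unfolding g1_def g2_def g3_def by (rule that)
qed

end

context order_basis
begin

text \<open>For u = p t the order just built contains f2 f3 / (p t), so e1 = s1 + p (f2 f3 / (p t))
  lies in O + pD for any maximal order D above it. The same D serves \<open>e2\<close> and
  \<open>e3\<close>.\<close>

lemma subset_ball_suborder:
  assumes det: "det f1 / (p * t) \<in> B 0" "det f2 / (p * t) \<in> B 0" "det f3 / (p * t) \<in> B 0"
    and pair: "trace (f2 ** f3) / (p * t) \<in> B 0" "trace (f3 ** f1) / (p * t) \<in> B 0"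
      "trace (f1 ** f2) / (p * t) \<in> B 0"
  obtains a m where "R \<subseteq> ball_suborder a m"
proof -
  have u: "p * t \<noteq> 0" using t_nz by simp
  obtain M where M: "is_order v M" "msc (1 / (p * t)) (f2 ** f3) \<in> M"
     "msc (1 / (p * t)) (f3 ** f1) \<in> M" "msc (1 / (p * t)) (f1 ** f2) \<in> M"
    using order_of_traceless[OF trace_f u det pair] .
  obtain a m where am: "M \<subseteq> ball_order a m" using M(1) by (rule order_subset_ball_order)
  note S = OK_moduleD[OF OK_module_ball_suborder[of a m]]
  have e_mem: "e' \<in> ball_suborder a m"
    if "msc (1 / (p * t)) f \<in> M" "f = msc t (e' - mat s)" "s \<in> B 0" for e' f s
  proof -
    have "msc p (msc (1 / (p * t)) f) \<in> ball_suborder a m"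
      using am that(1) by (blast intro: msc_p_mem_ball_suborder)
    moreover have "e' = msc p (msc (1 / (p * t)) f) + mat s"
      using t_nz by (simp add: that(2) msc_msc msc_1)
    ultimately show ?thesis using S(2) mat_mem_ball_suborder[OF that(3)] by metis
  qed
  have e': "e1 \<in> ball_suborder a m" "e2 \<in> ball_suborder a m" "e3 \<in> ball_suborder a m"
    using e_mem[OF M(2) prods(1) s_integral(1)] e_mem[OF M(3) prods(2) s_integral(2)]
      e_mem[OF M(4) prods(3) s_integral(3)] by auto
  have "R \<subseteq> ball_suborder a m"
  proof
    fix X assume "X \<in> R"
    then obtain c0 c1 c2 c3 where c: "c0 \<in> B 0" "c1 \<in> B 0" "c2 \<in> B 0" "c3 \<in> B 0"
      "X = mat c0 + msc c1 e1 + msc c2 e2 + msc c3 e3" using expand by blast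
    show "X \<in> ball_suborder a m"
      unfolding c(5) using c(1-4) e' by (intro S(2) S(3) mat_mem_ball_suborder)
  qed
  then show thesis by (rule that)
qed

text \<open>It suffices to test \<open>det / t\<close> on the vectors f and f + f': if none of these
  values is a unit, polarisation makes the pairings divisible by \<open>p\<close> too.\<close>

lemma gorenstein_or_subset:
  assumes full: "full_order v R"
  shows "gorenstein v R \<or> (\<exists>a m. R \<subseteq> ball_suborder a m)"
proof (rule disjCI)
  assume no: "\<nexists>a m. R \<subseteq> ball_suborder a m"
  let ?F = "{f1, f2, f3}"
  have fC: "f \<in> codifferent v R" if "f \<in> ?F" for f using that f_codifferent by auto
  have ftr: "trace f = 0" if "f \<in> ?F" for f using that trace_f by auto
  have *: "gorenstein v R" if "f \<in> ?F" "det f / (p * t) \<notin> B 0" for f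
    using that t_nz by (intro gorenstein_of_det[OF full ftr[OF that(1)] _ fC[OF that(1)]])
      (auto simp: prods_tR B_divide_iff v_mult, auto simp: B_iff)
  have **: "gorenstein v R" if f: "f \<in> ?F" "f' \<in> ?F" "det (f + f') / (p * t) \<notin> B 0" for f f'
  proof (rule gorenstein_of_det[OF full, of "f + f'"])
    show "trace (f + f') = 0" by (simp only: trace_add ftr[OF f(1)] ftr[OF f(2)] add_0)
    show "(f + f') ** g \<in> tR \<and> g ** (f + f') \<in> tR" if "g \<in> ?F" for g
      using prods_tR that f by (simp add: matrix_mult_distrib OK_module_add[OF OK_module_tR] del: insert_iff)
    show "f + f' \<in> codifferent v R" by (intro OK_module_add[OF OK_module_codifferent] fC f)
    show "det (f + f') \<noteq> 0" using f(3) by auto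
    show "v (det (f + f')) \<le> v t" using f(3) t_nz by (auto simp: B_divide_iff v_mult) (auto simp: B_iff)
  qed
  show "gorenstein v R"
  proof (rule ccontr)
    assume ng: "\<not> gorenstein v R"
    have det: "det f / (p * t) \<in> B 0" if "f \<in> ?F" for f using * ng that by blast
    have pair: "trace (f ** f') / (p * t) \<in> B 0" if "f \<in> ?F" "f' \<in> ?F" for f f'
    proof -
      have "det (f + f') / (p * t) \<in> B 0" using ** ng that by blast
      moreover have "trace (f ** f') = det f + det f' - det (f + f')"
        by (simp add: traceless_det_add[OF ftr[OF that(1)] ftr[OF that(2)]])
      ultimately show ?thesis
        using det[OF that(1)] det[OF that(2)]
        by (simp only: add_divide_distrib diff_divide_distrib B_add B_diff)
    qed
    have "\<exists>a m. R \<subseteq> ball_suborder a m"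
      by (rule subset_ball_suborder) (use det pair in auto)
    with no show False by blast
  qed
qed

end

section \<open>Choice of a basis and the equivalence\<close>

context valued_field
begin

text \<open>A triple of least valuation yields a basis to which \<open>gorenstein_or_subset\<close>
  applies; its dual vectors are normalised commutators.\<close>

lemma full_order_gorenstein_or_subset:
  assumes full: "full_order v R"
  shows "gorenstein v R \<or> (\<exists>a m. R \<subseteq> ball_suborder a m)"
proof -
  have R: "is_order v R" using full by (simp add: full_order_def)
  note om = order_mult[OF R] OK_moduleD[OF order_module[OF R]]
  let ?S = "{triple X Y Z |X Y Z. X \<in> R \<and> Y \<in> R \<and> Z \<in> R}"
  have triple_R: "triple X Y Z \<in> B 0" if "X \<in> R" "Y \<in> R" "Z \<in> R" for X Y Z
    unfolding triple_def comm_def by (intro order_trace[OF R] om that)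
  obtain c1 where c1: "c1 \<noteq> 0" "msc c1 (M2 0 1 0 0) \<in> R" using full by (rule full_order_scale)
  obtain c2 where c2: "c2 \<noteq> 0" "msc c2 (M2 0 0 1 0) \<in> R" using full by (rule full_order_scale)
  obtain c3 where c3: "c3 \<noteq> 0" "msc c3 (M2 1 0 0 0) \<in> R" using full by (rule full_order_scale)
  \<comment> \<open>Scaled matrix units show that some triple is nonzero.\<close>
  let ?t0 = "triple (msc c1 (M2 0 1 0 0)) (msc c2 (M2 0 0 1 0)) (msc c3 (M2 1 0 0 0))"
  have "?t0 = c1 * c2 * c3" by (simp add: triple_def)
  then have t0: "?t0 \<in> ?S" "?t0 \<noteq> 0" using c1 c2 c3 by (blast, simp)
  \<comment> \<open>By minimality the coefficients in Cramer's rule are integral, so 1,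
    \<open>e1\<close>, \<open>e2\<close>, \<open>e3\<close> span \<open>R\<close> over O.\<close>
  obtain w where w: "w \<in> ?S" "w \<noteq> 0" "\<And>y. y \<in> ?S \<Longrightarrow> y \<in> B (v w)"
    by (rule ex_min_valuation[OF _ t0, of 0]) (use triple_R in auto)
  then obtain e1 e2 e3 where e: "e1 \<in> R" "e2 \<in> R" "e3 \<in> R" "w = triple e1 e2 e3" by blast
  have w_min: "triple X Y Z / w \<in> B 0" if "X \<in> R" "Y \<in> R" "Z \<in> R" for X Y Z
    using w(3)[of "triple X Y Z"] that w(2) by (auto simp: B_divide_iff)
  have cyc: "triple e2 e3 e1 = w" "triple e3 e1 e2 = w"
    using triple_cyclic[of e1 e2 e3] triple_cyclic[of e2 e3 e1] by (simp_all add: e(4))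
  define f1 where "f1 = msc (1 / w) (comm e2 e3)"
  define f2 where "f2 = msc (1 / w) (comm e3 e1)"
  define f3 where "f3 = msc (1 / w) (comm e1 e2)"
  note f_defs = f1_def f2_def f3_def
  obtain r1 where r1: "comm e3 e1 ** comm e1 e2 = mat r1 - msc w e1"
    using comm_mult_comm[of e3 e1 e2] by (auto simp: e(4))
  obtain r2 where r2: "comm e1 e2 ** comm e2 e3 = mat r2 - msc w e2"
    using comm_mult_comm[of e1 e2 e3] by (auto simp: cyc)
  obtain r3 where r3: "comm e2 e3 ** comm e3 e1 = mat r3 - msc w e3"
    using comm_mult_comm[of e2 e3 e1] by (auto simp: cyc)
  \<comment> \<open>Dividing both commutators by \<open>w\<close> turns the factor -w of
    \<open>comm_mult_comm\<close> into -1 / w, the value taken for \<open>t\<close>.\<close>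
  have prod: "msc (1 / w) X ** msc (1 / w) Y = msc (- 1 / w) (e' - mat (r / w))"
    if "X ** Y = mat r - msc w e'" for X Y r e'
    using w(2) by (simp add: msc_mult_left msc_mult_right that msc_diff msc_msc msc_mat)
       (cases e' rule: M2_cases, simp add: mat_M2 field_simps)
  interpret order_basis v p R e1 e2 e3 f1 f2 f3 "- 1 / w" "r1 / w" "r2 / w" "r3 / w"
  proof
    show "\<exists>c0\<in>B 0. \<exists>c1\<in>B 0. \<exists>c2\<in>B 0. \<exists>c3\<in>B 0. X = mat c0 + msc c1 e1 + msc c2 e2 + msc c3 e3"
      if X: "X \<in> R" for X
    proof -
      obtain s where s: "msc w X =
          mat s + msc (triple X e2 e3) e1 + msc (triple X e3 e1) e2 + msc (triple X e1 e2) e3"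
        using triple_expand[of e1 e2 e3 X] by (auto simp: e(4))
      have "X = msc (1 / w) (msc w X)" using w(2) by (simp add: msc_msc msc_1)
      also have "\<dots> = mat (s / w) + msc (triple X e2 e3 / w) e1 + msc (triple X e3 e1 / w) e2
           + msc (triple X e1 e2 / w) e3"
        unfolding s by (simp add: msc_add msc_msc msc_mat)
      finally have X_eq: "X = mat (s / w) + msc (triple X e2 e3 / w) e1 + msc (triple X e3 e1 / w) e2
           + msc (triple X e1 e2 / w) e3" .
      have c: "triple X e2 e3 / w \<in> B 0" "triple X e3 e1 / w \<in> B 0" "triple X e1 e2 / w \<in> B 0"
        using w_min X e by auto
      \<comment> \<open>The remaining scalar is a difference of elements of \<open>R\<close>, hence
        integral.\<close>
      have "mat (s / w) = X - msc (triple X e2 e3 / w) e1 - msc (triple X e3 e1 / w) e2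
           - msc (triple X e1 e2 / w) e3"
        by (subst X_eq) simp
      also have "\<dots> \<in> R" using c X e by (intro om)
      finally have "s / w \<in> B 0" by (rule order_scalar[OF R])
      with c X_eq show ?thesis by blast
    qed
    show "Y = msc (trace (Y ** e1)) f1 + msc (trace (Y ** e2)) f2 + msc (trace (Y ** e3)) f3"
      if "trace Y = 0" for Y
    proof -
      have "Y = msc (1 / w) (msc w Y)" using w(2) by (simp add: msc_msc msc_1)
      then show ?thesis
        unfolding e(4) triple_expand_traceless[OF that] by (simp add: f_defs e(4) msc_add msc_msc)
    qed
    show "trace f1 = 0" "trace f2 = 0" "trace f3 = 0"
      by (simp_all add: f_defs trace_msc trace_comm)
    show "trace (f1 ** e1) = 1" "trace (f1 ** e2) = 0" "trace (f1 ** e3) = 0"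
      "trace (f2 ** e1) = 0" "trace (f2 ** e2) = 1" "trace (f2 ** e3) = 0"
      "trace (f3 ** e1) = 0" "trace (f3 ** e2) = 0" "trace (f3 ** e3) = 1"
      using w(2) cyc e(4) by (simp_all add: f_defs msc_mult_left trace_msc trace_comm_mult triple_eq_0)
    show "f2 ** f3 = msc (- 1 / w) (e1 - mat (r1 / w))" "f3 ** f1 = msc (- 1 / w) (e2 - mat (r2 / w))"
      "f1 ** f2 = msc (- 1 / w) (e3 - mat (r3 / w))"
      unfolding f_defs by (fact prod[OF r1] prod[OF r2] prod[OF r3])+
  qed (use R e w(2) in auto)
  show ?thesis by (rule gorenstein_or_subset[OF full])
qed

text \<open>If \<open>H\<close> lies in some O + pD, then this order is itself a non-Gorenstein
  order above \<open>H\<close>. Conversely, a non-Gorenstein order above \<open>H\<close> lies in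
  some O + pD, and so does \<open>H\<close>.\<close>

lemma bass_iff_line:
  assumes "full_order v H"
  shows "bass v H \<longleftrightarrow> is_line (branch v H) (bt_adj v)"
proof
  assume "bass v H"
  then have "\<not> H \<subseteq> ball_suborder a m" for a m
    using is_order_ball_suborder[of a m] not_gorenstein_ball_suborder[of a m] by (auto simp: bass_def)
  then show "is_line (branch v H) (bt_adj v)" using assms by (intro is_line_branch)
next
  assume line: "is_line (branch v H) (bt_adj v)"
  have "gorenstein v R" if "is_order v R" "H \<subseteq> R" for R
    using full_order_gorenstein_or_subset[OF full_order_superset[OF assms that]]
      not_line_of_subset_ball_suborder[of H] line that(2) by blast
  then show "bass v H" using assms by (simp add: bass_def)
qed

end

theorem theorem1p2:
  fixes v :: "'a::field \<Rightarrow> int" and H :: "'a mat2 set"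
  assumes "nonarch_local_field v"
    and "full_order v H"
  shows "bass v H \<longleftrightarrow> is_line (branch v H) (bt_adj v)"
proof -
  obtain p where "valued_field v p"
  proof -
    obtain p where p: "p \<noteq> 0" "v p = 1"
      using assms(1) unfolding nonarch_local_field_def by (elim conjE exE)
    from assms(1) have "valued_field v p"
      unfolding nonarch_local_field_def valued_field_def by (elim conjE) (intro conjI p)
    then show thesis by (rule that)
  qed
  then interpret valued_field v p .
  show ?thesis using assms(2) by (rule bass_iff_line)
qed

end
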